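(* In the Pearson setting described in the context, let $\tilde M^{\mathsf L}_n(z)=zM^{\mathsf L}_n(z)$ and $\tilde M^{\mathsf R}_n(z)=zM^{\mathsf R}_n(z)$, where $M^{\mathsf L}_n=(Z^{\mathsf L}_n)'(Z^{\mathsf L}_n)^{-1}$ and $M^{\mathsf R}_n=(Z^{\mathsf R}_n)^{-1}(Z^{\mathsf R}_n)'$ are the structure matrices, and for a square matrix function $F$ put $\mathcal N(F)(z)=F'(z)+\frac{F(z)^2}{z}$. Then for every $n\in\mathbb N$ $$z\big(Y^{\mathsf L}_n\big)''+\big(Y^{\mathsf L}_n\big)'\begin{bmatrix}2h^{\mathsf L}+I_N&0_N\\0_N&-2h^{\mathsf R}+I_N\end{bmatrix}+Y^{\mathsf L}_n\begin{bmatrix}\mathcal N(h^{\mathsf L})&0_N\\0_N&\mathcal N(-h^{\mathsf R})\end{bmatrix}=\mathcal N(\tilde M^{\mathsf L}_n)\,Y^{\mathsf L}_n,$$ $$z\big(Y^{\mathsf R}_n\big)''+\begin{bmatrix}2h^{\mathsf R}+I_N&0_N\\0_N&-2h^{\mathsf L}+I_N\end{bmatrix}\big(Y^{\mathsf R}_n\big)'+\begin{bmatrix}\mathcal N(h^{\mathsf R})&0_N\\0_N&\mathcal N(-h^{\mathsf L})\end{bmatrix}Y^{\mathsf R}_n=Y^{\mathsf R}_n\,\mathcal N(\tilde M^{\mathsf R}_n).$$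
   Context: $N\ge1$ is fixed, $\mathbb N=\{0,1,2,\dots\}$, $I_N$ and $0_N$ are the $N\times N$ identity and zero matrices. Curve: $\gamma\subset\mathbb C$ is a non self-intersecting smooth curve with one end point at $0$ and the other at $\infty$, meeting each circle $|z|=R$, $R>0$, exactly once. It is oriented from $0$ to $\infty$; the subscripts $+$ and $-$ denote boundary values on $\gamma$ from its left and right sides. $\log z$ is a branch on $\mathbb C\setminus\gamma$ and $z^A=e^{A\log z}$. Laguerre type matrix of weights: an $N\times N$ matrix function $W$ on $\gamma$, all of whose moments $W_n=\frac1{2\pi i}\int_\gamma z^nW(z)\,dz$ exist, with entries of the form $W^{(j,k)}(z)=\sum_{m\in I_{j,k}}h_m(z)z^{\alpha_m}\log^{p_m}z$, $z\in\gamma$, where $I_{j,k}$ is a finite index set, $\alpha_m>-1$, $p_m\in\mathbb N$, and $h_m$ is Hölder continuous, bounded and non-vanishing on $\gamma$, with a holomorphic extension to $\mathbb C$. It is regular if $\det[W_{j+k}]_{j,k=0,\dots,n}\ne0$ for all $n\in\mathbb N$. Pearson setting: $h^{\mathsf L},h^{\mathsf R}$ are $N\times N$ matrices of entire functions; $W^{\mathsf L},W^{\mathsf R}$ are invertible holomorphic solutions on $\mathbb C\setminus\gamma$ of $z(W^{\mathsf L})'=h^{\mathsf L}W^{\mathsf L}$, $z(W^{\mathsf R})'=W^{\mathsf R}h^{\mathsf R}$, written as $W^{\mathsf L}(z)=H^{\mathsf L}(z)z^{A^{\mathsf L}}W_0^{\mathsf L}$ and $W^{\mathsf R}(z)=W_0^{\mathsf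 R}z^{A^{\mathsf R}}H^{\mathsf R}(z)$, where $W_0^{\mathsf L},W_0^{\mathsf R}$ are constant nonsingular matrices, $H^{\mathsf L},H^{\mathsf R}$ are entire and nonsingular for $z\neq0$, and $A^{\mathsf L},A^{\mathsf R}$ are constant matrices with real spectra contained in $(-1,\infty)$. The weight is $W=(W^{\mathsf L}W^{\mathsf R})_+$ on $\gamma$, assumed to be a regular Laguerre type matrix of weights. Biorthogonal polynomials: $P_n^{\mathsf L},P_n^{\mathsf R}$ are the monic matrix polynomials of degree $n$ with $\frac1{2\pi i}\int_\gamma P_n^{\mathsf L}(z)W(z)z^k\,dz=\delta_{n,k}C_n^{-1}=\frac1{2\pi i}\int_\gamma z^kW(z)P_n^{\mathsf R}(z)\,dz$ for $k=0,\dots,n$, with $C_n$ nonsingular. Second kind functions: $Q_n^{\mathsf L}(z)=\frac1{2\pi i}\int_\gamma\frac{P_n^{\mathsf L}(z')}{z'-z}W(z')\,dz'$, $Q_n^{\mathsf R}(z)=\frac1{2\pi i}\int_\gamma W(z')\frac{P_n^{\mathsf R}(z')}{z'-z}\,dz'$. Put $$Y^{\mathsf L}_n=\begin{bmatrix}P^{\mathsf L}_n&Q^{\mathsf L}_n\\-C_{n-1}P^{\mathsf L}_{n-1}&-C_{n-1}Q^{\mathsf L}_{n-1}\end{bmatrix},\quad Y^{\mathsf R}_n=\begin{bmatrix}P^{\mathsf R}_n&-P^{\mathsf R}_{n-1}C_{n-1}\\Q^{\mathsf R}_n&-Q^{\mathsf R}_{n-1}C_{n-1}\end{bmatrix}$$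 (both have determinant $1$ on $\mathbb C\setminus\gamma$), with the convention, for $n=0$, $C_{-1}P_{-1}^{\mathsf L}=P_{-1}^{\mathsf R}C_{-1}=0_N$ and $-C_{-1}Q_{-1}^{\mathsf L}=-Q_{-1}^{\mathsf R}C_{-1}=I_N$. Finally $$Z_n^{\mathsf L}=Y^{\mathsf L}_n\begin{bmatrix}W^{\mathsf L}&0_N\\0_N&(W^{\mathsf R})^{-1}\end{bmatrix},\qquad Z^{\mathsf R}_n=\begin{bmatrix}W^{\mathsf R}&0_N\\0_N&(W^{\mathsf L})^{-1}\end{bmatrix}Y^{\mathsf R}_n\qquad\text{on }\mathbb C\setminus\gamma.$$ *)

theory Defs
  imports "HOL-Analysis.Analysis"
begin

type_synonym 'n cmat = "complex ^ 'n ^ 'n"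

text \<open>Matrix algebra and calculus. Matrix products and inverses are the library's \<open>**\<close> and
  \<open>matrix_inv\<close>; the operations below are the ones it does not provide.\<close>

definition smult_mat :: "complex \<Rightarrow> 'n::finite cmat \<Rightarrow> 'n cmat"  (infixr "\<cdot>\<^sub>m" 75)
  where "c \<cdot>\<^sub>m A = (\<chi> i j. c * A $ i $ j)"

primrec mat_pow :: "'n::finite cmat \<Rightarrow> nat \<Rightarrow> 'n cmat" where
  "mat_pow A 0 = mat 1"
| "mat_pow A (Suc k) = A ** mat_pow A k"

definition mat_exp :: "'n::finite cmat \<Rightarrow> 'n cmat"
  where "mat_exp A = (\<Sum>k. (1 / fact k) \<cdot>\<^sub>m mat_pow A k)"

definition mat_eigenvalue :: "'n::finite cmat \<Rightarrow> complex \<Rightarrow> bool"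
  where "mat_eigenvalue A l \<longleftrightarrow> (\<exists>v. v \<noteq> 0 \<and> A *v v = l *s v)"

definition block_mat :: "'n::finite cmat \<Rightarrow> 'n cmat \<Rightarrow> 'n cmat \<Rightarrow> 'n cmat \<Rightarrow> ('n + 'n) cmat"
  where "block_mat A B C D = (\<chi> i j.
    case i of
      Inl a \<Rightarrow> (case j of Inl b \<Rightarrow> A $ a $ b | Inr b \<Rightarrow> B $ a $ b)
    | Inr a \<Rightarrow> (case j of Inl b \<Rightarrow> C $ a $ b | Inr b \<Rightarrow> D $ a $ b))"

abbreviation block_diag :: "'n::finite cmat \<Rightarrow> 'n cmat \<Rightarrow> ('n + 'n) cmat"
  where "block_diag A D \<equiv> block_mat A 0 0 D"

definition mat_holomorphic_on :: "(complex \<Rightarrow> 'n::finite cmat) \<Rightarrow> complex set \<Rightarrow> bool"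
  where "mat_holomorphic_on F S \<longleftrightarrow> (\<forall>i j. (\<lambda>z. F z $ i $ j) holomorphic_on S)"

definition mat_deriv :: "(complex \<Rightarrow> 'n::finite cmat) \<Rightarrow> complex \<Rightarrow> 'n cmat"
  where "mat_deriv F z = (\<chi> i j. deriv (\<lambda>w. F w $ i $ j) z)"

text \<open>The library determinant formula over an arbitrary finite index set, so that the size of a
  matrix may depend on a natural number.\<close>

definition det_on :: "'i set \<Rightarrow> ('i \<Rightarrow> 'i \<Rightarrow> complex) \<Rightarrow> complex"
  where "det_on I A = (\<Sum>p | p permutes I. of_int (sign p) * (\<Prod>i\<in>I. A i (p i)))"


text \<open>A curve from \<open>0\<close> to \<open>\<infinity>\<close> is given by a parametrization \<open>g\<close> on \<open>{0..}\<close>, oriented by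
  increasing parameter; smoothness is that of a regular \<open>C\<^sup>1\<close> curve away from the end point \<open>0\<close>.\<close>

definition curve_set :: "(real \<Rightarrow> complex) \<Rightarrow> complex set"
  where "curve_set g = g ` {0..}"

definition laguerre_curve :: "(real \<Rightarrow> complex) \<Rightarrow> bool"
  where "laguerre_curve g \<longleftrightarrow>
    continuous_on {0..} g \<and> inj_on g {0..} \<and>
    g C1_differentiable_on {0<..} \<and> (\<forall>t>0. vector_derivative g (at t) \<noteq> 0) \<and>
    g 0 = 0 \<and> filterlim g at_infinity at_top \<and>
    (\<forall>R>0. \<exists>!z. z \<in> curve_set g \<and> cmod z = R)"

definition curve_integrable :: "(real \<Rightarrow> complex) \<Rightarrow> (complex \<Rightarrow> 'n::finite cmat) \<Rightarrow> bool"
  where "curve_integrable g F \<longleftrightarrow>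
    set_integrable lborel {0<..} (\<lambda>t. vector_derivative g (at t) \<cdot>\<^sub>m F (g t))"

definition curve_integral :: "(real \<Rightarrow> complex) \<Rightarrow> (complex \<Rightarrow> 'n::finite cmat) \<Rightarrow> 'n cmat"
  where "curve_integral g F =
    set_lebesgue_integral lborel {0<..} (\<lambda>t. vector_derivative g (at t) \<cdot>\<^sub>m F (g t))"

text \<open>All integrals carry the factor \<open>1 / (2 \<pi> \<i>)\<close>.\<close>

definition curve_integral_2pii :: "(real \<Rightarrow> complex) \<Rightarrow> (complex \<Rightarrow> 'n::finite cmat) \<Rightarrow> 'n cmat"
  where "curve_integral_2pii g F = (1 / (2 * of_real pi * \<i>)) \<cdot>\<^sub>m curve_integral g F"

text \<open>The curve meets each circle about \<open>0\<close> in exactly one point and runs outwards, so its left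
  side is the counterclockwise one: \<open>z\<close> near the curve lies to the left iff it is obtained from the
  point \<open>w\<close> of the curve on the same circle by a rotation with angle in \<open>(0, \<pi>)\<close>.\<close>

definition left_side :: "complex set \<Rightarrow> complex set"
  where "left_side \<gamma> = {z. \<exists>w\<in>\<gamma>. cmod w = cmod z \<and> Im (z / w) > 0}"

definition has_left_boundary_values ::
    "complex set \<Rightarrow> (complex \<Rightarrow> 'a::topological_space) \<Rightarrow> (complex \<Rightarrow> 'a) \<Rightarrow> bool"
  where "has_left_boundary_values \<gamma> F Fp \<longleftrightarrow>
    (\<forall>w\<in>\<gamma> - {0}. (F \<longlongrightarrow> Fp w) (at w within left_side \<gamma>))"

definition log_branch :: "complex set \<Rightarrow> (complex \<Rightarrow> complex) \<Rightarrow> bool"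
  where "log_branch \<gamma> lg \<longleftrightarrow> lg holomorphic_on - \<gamma> \<and> (\<forall>z\<in>- \<gamma>. exp (lg z) = z)"


definition moment :: "(real \<Rightarrow> complex) \<Rightarrow> (complex \<Rightarrow> 'n::finite cmat) \<Rightarrow> nat \<Rightarrow> 'n cmat"
  where "moment g W n = curve_integral_2pii g (\<lambda>z. z ^ n \<cdot>\<^sub>m W z)"

definition hoelder_on :: "complex set \<Rightarrow> (complex \<Rightarrow> complex) \<Rightarrow> bool"
  where "hoelder_on S h \<longleftrightarrow> (\<exists>K \<mu>. 0 < \<mu> \<and> \<mu> \<le> 1 \<and>
    (\<forall>z\<in>S. \<forall>w\<in>S. cmod (h z - h w) \<le> K * cmod (z - w) powr \<mu>))"

text \<open>\<open>lgp\<close> is the determination of the logarithm along the curve; \<open>z\<^sup>\<alpha>\<close> is \<open>exp (\<alpha> * lgp z)\<close>.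
  The functions \<open>h m\<close> are given through their entire extensions.\<close>

definition laguerre_weight ::
    "(real \<Rightarrow> complex) \<Rightarrow> (complex \<Rightarrow> complex) \<Rightarrow> (complex \<Rightarrow> 'n::finite cmat) \<Rightarrow> bool"
  where "laguerre_weight g lgp W \<longleftrightarrow>
    (\<forall>n. curve_integrable g (\<lambda>z. z ^ n \<cdot>\<^sub>m W z)) \<and>
    (\<forall>j k. \<exists>(I :: nat set) (h :: nat \<Rightarrow> complex \<Rightarrow> complex) (\<alpha> :: nat \<Rightarrow> real) (p :: nat \<Rightarrow> nat).
      finite I \<and>
      (\<forall>m\<in>I. \<alpha> m > - 1 \<and> h m holomorphic_on UNIV \<and> hoelder_on (curve_set g) (h m) \<and>
        bounded (h m ` curve_set g) \<and> (\<forall>z\<in>curve_set g. h m z \<noteq> 0)) \<and>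
      (\<forall>z\<in>curve_set g - {0}.
        W z $ j $ k = (\<Sum>m\<in>I. h m z * exp (of_real (\<alpha> m) * lgp z) * lgp z ^ p m)))"

definition regular_weight :: "(real \<Rightarrow> complex) \<Rightarrow> (complex \<Rightarrow> 'n::finite cmat) \<Rightarrow> bool"
  where "regular_weight g W \<longleftrightarrow> (\<forall>n::nat.
    det_on ({0..n} \<times> (UNIV :: 'n set)) (\<lambda>(j, a) (k, b). moment g W (j + k) $ a $ b) \<noteq> 0)"


definition monic_mat_poly :: "nat \<Rightarrow> (complex \<Rightarrow> 'n::finite cmat) \<Rightarrow> bool"
  where "monic_mat_poly n P \<longleftrightarrow>
    (\<exists>c. \<forall>z. P z = z ^ n \<cdot>\<^sub>m mat 1 + (\<Sum>k<n. z ^ k \<cdot>\<^sub>m c k))"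

definition biorthogonal ::
    "(real \<Rightarrow> complex) \<Rightarrow> (complex \<Rightarrow> 'n::finite cmat) \<Rightarrow>
     (nat \<Rightarrow> complex \<Rightarrow> 'n cmat) \<Rightarrow> (nat \<Rightarrow> complex \<Rightarrow> 'n cmat) \<Rightarrow> (nat \<Rightarrow> 'n cmat) \<Rightarrow> bool"
  where "biorthogonal g W PL PR C \<longleftrightarrow> (\<forall>n.
    monic_mat_poly n (PL n) \<and> monic_mat_poly n (PR n) \<and> invertible (C n) \<and>
    (\<forall>k\<le>n.
      curve_integral_2pii g (\<lambda>z. z ^ k \<cdot>\<^sub>m (PL n z ** W z))
        = (if n = k then matrix_inv (C n) else 0) \<and>
      curve_integral_2pii g (\<lambda>z. z ^ k \<cdot>\<^sub>m (W z ** PR n z))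
        = (if n = k then matrix_inv (C n) else 0)))"

definition second_kind_L ::
    "(real \<Rightarrow> complex) \<Rightarrow> (complex \<Rightarrow> 'n::finite cmat) \<Rightarrow> (complex \<Rightarrow> 'n cmat) \<Rightarrow> complex \<Rightarrow> 'n cmat"
  where "second_kind_L g W P z = curve_integral_2pii g (\<lambda>w. (1 / (w - z)) \<cdot>\<^sub>m (P w ** W w))"

definition second_kind_R ::
    "(real \<Rightarrow> complex) \<Rightarrow> (complex \<Rightarrow> 'n::finite cmat) \<Rightarrow> (complex \<Rightarrow> 'n cmat) \<Rightarrow> complex \<Rightarrow> 'n cmat"
  where "second_kind_R g W P z = curve_integral_2pii g (\<lambda>w. (1 / (w - z)) \<cdot>\<^sub>m (W w ** P w))"

definition Y_L ::
    "(real \<Rightarrow> complex) \<Rightarrow> (complex \<Rightarrow> 'n::finite cmat) \<Rightarrow> (nat \<Rightarrow> complex \<Rightarrow> 'n cmat) \<Rightarrow>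
     (nat \<Rightarrow> 'n cmat) \<Rightarrow> nat \<Rightarrow> complex \<Rightarrow> ('n + 'n) cmat"
  where "Y_L g W PL C n z = (case n of
      0 \<Rightarrow> block_mat (PL 0 z) (second_kind_L g W (PL 0) z) 0 (mat 1)
    | Suc m \<Rightarrow> block_mat (PL n z) (second_kind_L g W (PL n) z)
        (- (C m ** PL m z)) (- (C m ** second_kind_L g W (PL m) z)))"

definition Y_R ::
    "(real \<Rightarrow> complex) \<Rightarrow> (complex \<Rightarrow> 'n::finite cmat) \<Rightarrow> (nat \<Rightarrow> complex \<Rightarrow> 'n cmat) \<Rightarrow>
     (nat \<Rightarrow> 'n cmat) \<Rightarrow> nat \<Rightarrow> complex \<Rightarrow> ('n + 'n) cmat"
  where "Y_R g W PR C n z = (case n of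
      0 \<Rightarrow> block_mat (PR 0 z) 0 (second_kind_R g W (PR 0) z) (mat 1)
    | Suc m \<Rightarrow> block_mat (PR n z) (- (PR m z ** C m))
        (second_kind_R g W (PR n) z) (- (second_kind_R g W (PR m) z ** C m)))"

definition Z_L ::
    "(complex \<Rightarrow> ('n::finite + 'n) cmat) \<Rightarrow> (complex \<Rightarrow> 'n cmat) \<Rightarrow> (complex \<Rightarrow> 'n cmat) \<Rightarrow>
     complex \<Rightarrow> ('n + 'n) cmat"
  where "Z_L Y WL WR z = Y z ** block_diag (WL z) (matrix_inv (WR z))"

definition Z_R ::
    "(complex \<Rightarrow> ('n::finite + 'n) cmat) \<Rightarrow> (complex \<Rightarrow> 'n cmat) \<Rightarrow> (complex \<Rightarrow> 'n cmat) \<Rightarrow>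
     complex \<Rightarrow> ('n + 'n) cmat"
  where "Z_R Y WL WR z = block_diag (WR z) (matrix_inv (WL z)) ** Y z"

definition M_L :: "(complex \<Rightarrow> 'm::finite cmat) \<Rightarrow> complex \<Rightarrow> 'm cmat"
  where "M_L Z z = mat_deriv Z z ** matrix_inv (Z z)"

definition M_R :: "(complex \<Rightarrow> 'm::finite cmat) \<Rightarrow> complex \<Rightarrow> 'm cmat"
  where "M_R Z z = matrix_inv (Z z) ** mat_deriv Z z"

definition calN :: "(complex \<Rightarrow> 'm::finite cmat) \<Rightarrow> complex \<Rightarrow> 'm cmat"
  where "calN F z = mat_deriv F z + (1 / z) \<cdot>\<^sub>m (F z ** F z)"

text \<open>In \<open>pearson_L\<close> and \<open>pearson_R\<close> below the power \<open>z\<^sup>A\<close> is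
  \<open>mat_exp (lg z \<cdot>\<^sub>m A)\<close>.\<close>

definition pearson_data ::
    "complex set \<Rightarrow> (complex \<Rightarrow> 'n::finite cmat) \<Rightarrow> (complex \<Rightarrow> 'n cmat) \<Rightarrow>
     (complex \<Rightarrow> 'n cmat) \<Rightarrow> 'n cmat \<Rightarrow> 'n cmat \<Rightarrow> bool"
  where "pearson_data \<gamma> h W H A W0 \<longleftrightarrow>
    mat_holomorphic_on h UNIV \<and>
    mat_holomorphic_on W (- \<gamma>) \<and> (\<forall>z\<in>- \<gamma>. invertible (W z)) \<and>
    mat_holomorphic_on H UNIV \<and> (\<forall>z. z \<noteq> 0 \<longrightarrow> invertible (H z)) \<and>
    (\<forall>l. mat_eigenvalue A l \<longrightarrow> l \<in> \<real> \<and> Re l > - 1) \<and>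
    invertible W0"

definition pearson_L ::
    "complex set \<Rightarrow> (complex \<Rightarrow> complex) \<Rightarrow> (complex \<Rightarrow> 'n::finite cmat) \<Rightarrow> (complex \<Rightarrow> 'n cmat) \<Rightarrow>
     (complex \<Rightarrow> 'n cmat) \<Rightarrow> 'n cmat \<Rightarrow> 'n cmat \<Rightarrow> bool"
  where "pearson_L \<gamma> lg h W H A W0 \<longleftrightarrow> pearson_data \<gamma> h W H A W0 \<and>
    (\<forall>z\<in>- \<gamma>. z \<cdot>\<^sub>m mat_deriv W z = h z ** W z \<and>
      W z = H z ** mat_exp (lg z \<cdot>\<^sub>m A) ** W0)"

definition pearson_R ::
    "complex set \<Rightarrow> (complex \<Rightarrow> complex) \<Rightarrow> (complex \<Rightarrow> 'n::finite cmat) \<Rightarrow> (complex \<Rightarrow> 'n cmat) \<Rightarrow>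
     (complex \<Rightarrow> 'n cmat) \<Rightarrow> 'n cmat \<Rightarrow> 'n cmat \<Rightarrow> bool"
  where "pearson_R \<gamma> lg h W H A W0 \<longleftrightarrow> pearson_data \<gamma> h W H A W0 \<and>
    (\<forall>z\<in>- \<gamma>. z \<cdot>\<^sub>m mat_deriv W z = W z ** h z \<and>
      W z = W0 ** mat_exp (lg z \<cdot>\<^sub>m A) ** H z)"

end

theory Submission
  imports Defs "HOL-Complex_Analysis.Cauchy_Integral_Formula"
begin

text \<open>The matrix \<open>D = diag(W\<^sup>L, (W\<^sup>R)\<^sup>-\<^sup>1)\<close> satisfies \<open>z D' = B D\<close> with
  \<open>B = diag(h\<^sup>L, -h\<^sup>R)\<close>, so \<open>Z = Y D\<close> has \<open>M Y = z Y' + Y B\<close> for \<open>M = z Z' Z\<^sup>-\<^sup>1\<close>;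
  differentiating this identity once more gives the second order equation. The right equation is the
  transposed statement. What has to be known about \<open>Y\<close> is that it is holomorphic and invertible off
  the curve. Invertibility is obtained without a Riemann-Hilbert argument: by biorthogonality,
  \<open>Q\<^sup>L\<^sub>m P\<^sup>R\<^sub>k - P\<^sup>L\<^sub>m Q\<^sup>R\<^sub>k\<close> is \<open>C\<^sub>k\<^sup>-\<^sup>1\<close>, \<open>0\<close> or
  \<open>-C\<^sub>m\<^sup>-\<^sup>1\<close> for \<open>m = k + 1\<close>, \<open>m = k\<close> and \<open>k = m + 1\<close>, which exhibits
  the inverse of \<open>Y\<^sup>L\<close> as a block permutation of \<open>Y\<^sup>R\<close>.\<close>

subsection \<open>Matrix calculus\<close>

lemma smult_mat_nth [simp]: "(c \<cdot>\<^sub>m A) $ i $ j = c * A $ i $ j"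
  by (simp add: smult_mat_def)

lemma smult_mat_mult_left [simp]: "(c \<cdot>\<^sub>m A) ** B = c \<cdot>\<^sub>m (A ** B)"
  by (simp add: vec_eq_iff matrix_matrix_mult_def sum_distrib_left mult_ac)

lemma smult_mat_mult_right [simp]: "A ** (c \<cdot>\<^sub>m B) = c \<cdot>\<^sub>m (A ** B)"
  by (simp add: vec_eq_iff matrix_matrix_mult_def sum_distrib_left mult_ac)

lemma smult_mat_smult [simp]: "a \<cdot>\<^sub>m b \<cdot>\<^sub>m A = (a * b) \<cdot>\<^sub>m A"
  by (simp add: vec_eq_iff)

lemma smult_mat_one [simp]: "1 \<cdot>\<^sub>m A = A"
  by (simp add: vec_eq_iff)

lemma smult_mat_add: "c \<cdot>\<^sub>m (A + B) = c \<cdot>\<^sub>m A + c \<cdot>\<^sub>m B"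
  by (simp add: vec_eq_iff algebra_simps)

lemma smult_mat_minus [simp]: "c \<cdot>\<^sub>m (- A) = - (c \<cdot>\<^sub>m A)"
  by (simp add: vec_eq_iff)

lemma smult_mat_diff: "c \<cdot>\<^sub>m (A - B) = c \<cdot>\<^sub>m A - c \<cdot>\<^sub>m B"
  by (simp add: vec_eq_iff algebra_simps)

lemma matrix_mult_minus_left [simp]: "(- A) ** B = - (A ** B)"
  for A :: "'a::comm_ring_1^'n^'m"
  by (simp add: vec_eq_iff matrix_matrix_mult_def sum_negf)

lemma matrix_mult_minus_right [simp]: "A ** (- B) = - (A ** B)"
  for A :: "'a::comm_ring_1^'n^'m"
  by (simp add: vec_eq_iff matrix_matrix_mult_def sum_negf)

lemma matrix_mult_add_left: "(A + B) ** C = A ** C + B ** C"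
  for A :: "'a::semiring_1^'n^'m"
  by (simp add: vec_eq_iff matrix_matrix_mult_def distrib_right sum.distrib)

lemma matrix_mult_diff_left: "(A - B) ** C = A ** C - B ** C"
  for A :: "'a::comm_ring_1^'n^'m"
  by (simp add: vec_eq_iff matrix_matrix_mult_def left_diff_distrib sum_subtractf)

lemma matrix_mult_diff_right: "A ** (B - C) = A ** B - A ** C"
  for A :: "'a::comm_ring_1^'n^'m"
  by (simp add: vec_eq_iff matrix_matrix_mult_def right_diff_distrib sum_subtractf)

section \<open>Inverses, Cramer's rule and transposes\<close>

lemma matrix_inv_left_right:
  fixes A :: "'a::field^'n^'n"
  assumes "invertible A"
  shows "A ** matrix_inv A = mat 1" "matrix_inv A ** A = mat 1"
proof -
  have "\<exists>B. A ** B = mat 1 \<and> B ** A = mat 1"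
    using assms by (auto simp: invertible_def)
  then have "A ** matrix_inv A = mat 1 \<and> matrix_inv A ** A = mat 1"
    unfolding matrix_inv_def by (rule someI_ex)
  then show "A ** matrix_inv A = mat 1" "matrix_inv A ** A = mat 1" by auto
qed

lemma invertible_matrix_inv:
  fixes A :: "'a::field^'n^'n"
  assumes "invertible A"
  shows "invertible (matrix_inv A)"
  using matrix_inv_left_right[OF assms] by (auto simp: invertible_def)

text \<open>Over a field a one-sided inverse of a square matrix is two-sided, so a single product
  suffices to identify the inverse.\<close>

lemma matrix_inv_eqI:
  fixes A :: "'a::field^'n^'n"
  assumes "A ** B = mat 1"
  shows "matrix_inv A = B"
proof -
  have "invertible A"
    using assms matrix_left_right_inverse unfolding invertible_def by blast
  then have "matrix_inv A ** (A ** B) = B"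
    by (simp add: matrix_mul_assoc matrix_inv_left_right)
  then show ?thesis by (simp add: assms)
qed

lemma matrix_inv_transpose:
  fixes A :: "'a::field^'n^'n"
  assumes "invertible A"
  shows "matrix_inv (transpose A) = transpose (matrix_inv A)"
  by (rule matrix_inv_eqI)
     (simp add: matrix_transpose_mul[symmetric] matrix_inv_left_right[OF assms])

lemma invertible_transpose_field:
  fixes A :: "'a::field^'n^'n"
  shows "invertible (transpose A) \<longleftrightarrow> invertible A"
  by (simp add: invertible_det_nz det_transpose)

text \<open>Serves to see that the inverse depends holomorphically on the matrix: both determinants
  are polynomials in the entries.\<close>

lemma matrix_inv_nth_cramer:
  fixes A :: "'a::field^'n^'n"
  assumes "invertible A"
  shows "matrix_inv A $ k $ l = det (\<chi> i j. if j = k then mat 1 $ i $ l else A $ i $ j) / det A"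
proof -
  \<comment> \<open>Column \<open>l\<close> of the inverse solves the linear system whose right-hand
    side is column \<open>l\<close> of the identity; Cramer's rule applies to this system.\<close>
  have "A *v column l (matrix_inv A) = column l (mat 1)"
    using arg_cong[OF matrix_inv_left_right(1)[OF assms], of "column l"]
    by (simp add: vec_eq_iff column_def matrix_vector_mult_def matrix_matrix_mult_def)
  then have "column l (matrix_inv A)
      = (\<chi> k. det (\<chi> i j. if j = k then column l (mat 1) $ i else A $ i $ j) / det A)"
    using cramer[of A] assms by (auto simp: invertible_det_nz)
  then show ?thesis by (simp add: column_def vec_eq_iff cong: if_cong)
qed

lemma transpose_smult_mat [simp]: "transpose (c \<cdot>\<^sub>m A) = c \<cdot>\<^sub>m transpose A"
  by (simp add: vec_eq_iff transpose_def)

lemma transpose_add [simp]: "transpose (A + B) = transpose A + transpose B"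
  by (simp add: vec_eq_iff transpose_def)

section \<open>Block matrices indexed by a sum type\<close>

lemma sum_UNIV_sum_type:
  fixes f :: "'a::finite + 'b::finite \<Rightarrow> 'c::comm_monoid_add"
  shows "sum f UNIV = (\<Sum>i\<in>UNIV. f (Inl i)) + (\<Sum>i\<in>UNIV. f (Inr i))"
  using sum.Plus[of UNIV UNIV f] by (simp add: o_def)

lemma block_mat_mult:
  "block_mat A B C D ** block_mat A' B' C' D'
    = block_mat (A ** A' + B ** C') (A ** B' + B ** D') (C ** A' + D ** C') (C ** B' + D ** D')"
  by (simp add: vec_eq_iff block_mat_def matrix_matrix_mult_def sum_UNIV_sum_type split: sum.split)

lemma block_mat_add: "block_mat A B C D + block_mat A' B' C' D'
    = block_mat (A + A') (B + B') (C + C') (D + D')"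
  by (auto simp: vec_eq_iff block_mat_def split: sum.splits)

lemma smult_block_mat: "c \<cdot>\<^sub>m block_mat A B C D
    = block_mat (c \<cdot>\<^sub>m A) (c \<cdot>\<^sub>m B) (c \<cdot>\<^sub>m C) (c \<cdot>\<^sub>m D)"
  by (auto simp: vec_eq_iff block_mat_def split: sum.splits)

lemma mat_one_block: "mat 1 = block_diag (mat 1) (mat 1)"
  by (auto simp: vec_eq_iff block_mat_def mat_def split: sum.splits)

lemma smult_mat_zero [simp]: "c \<cdot>\<^sub>m 0 = 0"
  by (simp add: vec_eq_iff)

text \<open>The four hypotheses are the four blocks of a product
  \<open>[p q; r s] [d -c; -b a] = 1\<close>, and the same equations, arranged differently, say
  \<open>[s -r; -q p] [a b; c d] = 1\<close>. With \<open>[p q; r s]\<close> the left matrix Y and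
  \<open>[a b; c d]\<close> the right one, both become invertible at once.\<close>

lemma block_mat_cross_inverse:
  fixes p q r s a b c d :: "'n::finite cmat"
  assumes "p ** d - q ** b = mat 1" "q ** a = p ** c" "r ** d = s ** b" "s ** a - r ** c = mat 1"
  shows "invertible (block_mat p q r s)" "invertible (block_mat a b c d)"
proof -
  have "block_mat p q r s ** block_mat d (- c) (- b) a = mat 1"
    using assms by (simp add: block_mat_mult mat_one_block)
  then show "invertible (block_mat p q r s)"
    using matrix_left_right_inverse unfolding invertible_def by blast
  have "block_mat s (- r) (- q) p ** block_mat a b c d = mat 1"
    using assms by (simp add: block_mat_mult mat_one_block)
  then show "invertible (block_mat a b c d)"
    using matrix_left_right_inverse unfolding invertible_def by blast
qed

lemma invertible_block_diag:
  assumes "invertible A" "invertible D"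
  shows "invertible (block_diag A D)"
proof -
  have "block_diag A D ** block_diag (matrix_inv A) (matrix_inv D) = mat 1"
    using assms by (simp add: block_mat_mult mat_one_block matrix_inv_left_right)
  then show ?thesis
    using matrix_left_right_inverse unfolding invertible_def by blast
qed

section \<open>Holomorphic matrix functions\<close>

lemma mat_holomorphic_onI: "(\<And>i j. (\<lambda>z. F z $ i $ j) holomorphic_on S) \<Longrightarrow> mat_holomorphic_on F S"
  by (simp add: mat_holomorphic_on_def)

lemma mat_holomorphic_onD: "mat_holomorphic_on F S \<Longrightarrow> (\<lambda>z. F z $ i $ j) holomorphic_on S"
  by (simp add: mat_holomorphic_on_def)

lemma mat_holomorphic_on_const: "mat_holomorphic_on (\<lambda>z. A) S"
  by (simp add: mat_holomorphic_on_def)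

lemma mat_holomorphic_on_mult:
  "mat_holomorphic_on F S \<Longrightarrow> mat_holomorphic_on G S \<Longrightarrow> mat_holomorphic_on (\<lambda>z. F z ** G z) S"
  by (auto simp: mat_holomorphic_on_def matrix_matrix_mult_def intro!: holomorphic_intros)

lemma mat_holomorphic_on_minus:
  "mat_holomorphic_on F S \<Longrightarrow> mat_holomorphic_on (\<lambda>z. - F z) S"
  by (auto simp: mat_holomorphic_on_def intro!: holomorphic_intros)

lemma mat_holomorphic_on_smult:
  "f holomorphic_on S \<Longrightarrow> mat_holomorphic_on F S \<Longrightarrow> mat_holomorphic_on (\<lambda>z. f z \<cdot>\<^sub>m F z) S"
  by (auto simp: mat_holomorphic_on_def intro!: holomorphic_intros)

lemma mat_holomorphic_on_transpose:
  "mat_holomorphic_on F S \<Longrightarrow> mat_holomorphic_on (\<lambda>z. transpose (F z)) S"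
  by (auto simp: mat_holomorphic_on_def transpose_def)

lemma mat_holomorphic_on_sum:
  "(\<And>k. k \<in> I \<Longrightarrow> mat_holomorphic_on (F k) S) \<Longrightarrow> mat_holomorphic_on (\<lambda>z. \<Sum>k\<in>I. F k z) S"
  by (auto simp: mat_holomorphic_on_def intro!: holomorphic_intros)

lemma mat_holomorphic_on_block:
  assumes "mat_holomorphic_on A S" "mat_holomorphic_on B S" "mat_holomorphic_on C S"
    "mat_holomorphic_on D S"
  shows "mat_holomorphic_on (\<lambda>z. block_mat (A z) (B z) (C z) (D z)) S"
proof (rule mat_holomorphic_onI)
  fix i j :: "'a + 'a"
  show "(\<lambda>z. block_mat (A z) (B z) (C z) (D z) $ i $ j) holomorphic_on S"
    using assms by (cases i; cases j) (simp_all add: block_mat_def mat_holomorphic_on_def)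
qed

text \<open>By Cramer's rule every entry is a quotient of polynomials in the entries of
  \<open>F\<close>, with denominator \<open>det (F z)\<close>, which does not vanish on
  \<open>S\<close>.\<close>

lemma mat_holomorphic_on_matrix_inv:
  assumes "mat_holomorphic_on F S" "\<And>z. z \<in> S \<Longrightarrow> invertible (F z)"
  shows "mat_holomorphic_on (\<lambda>z. matrix_inv (F z)) S"
proof (rule mat_holomorphic_onI)
  fix k l
  have "(\<lambda>z. det (\<chi> i j. if j = k then mat 1 $ i $ l else F z $ i $ j) / det (F z)) holomorphic_on S"
    unfolding det_def
  proof (intro holomorphic_intros)
    fix p i
    \<comment> \<open>In the replaced column the factor is a constant, elsewhere it is an entry of
      \<open>F\<close>.\<close>
    show "(\<lambda>z. (\<chi> i j. if j = k then mat 1 $ i $ l else F z $ i $ j) $ i $ p i) holomorphic_on S"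
      using mat_holomorphic_onD[OF assms(1)] by (cases "p i = k") auto
    show "(\<lambda>z. F z $ i $ p i) holomorphic_on S"
      using mat_holomorphic_onD[OF assms(1)] .
    fix z assume "z \<in> S"
    then show "(\<Sum>p | p permutes UNIV. of_int (sign p) * (\<Prod>i\<in>UNIV. F z $ i $ p i)) \<noteq> 0"
      using assms(2) by (simp add: invertible_det_nz flip: det_def)
  qed
  then show "(\<lambda>z. matrix_inv (F z) $ k $ l) holomorphic_on S"
    by (rule holomorphic_transform) (simp add: matrix_inv_nth_cramer assms(2))
qed

lemma mat_holomorphic_on_subset:
  "mat_holomorphic_on F S \<Longrightarrow> T \<subseteq> S \<Longrightarrow> mat_holomorphic_on F T"
  by (auto simp: mat_holomorphic_on_def intro: holomorphic_on_subset)

lemma mat_holomorphic_on_deriv: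
  "mat_holomorphic_on F S \<Longrightarrow> open S \<Longrightarrow> mat_holomorphic_on (mat_deriv F) S"
  by (simp add: mat_holomorphic_on_def mat_deriv_def holomorphic_deriv)

section \<open>Derivatives at a point of an open set\<close>

context
  fixes S :: "complex set" and z :: complex
  assumes S: "open S" "z \<in> S"
begin

lemma has_field_derivative_mat_deriv:
  assumes "mat_holomorphic_on F S"
  shows "((\<lambda>w. F w $ i $ j) has_field_derivative mat_deriv F z $ i $ j) (at z)"
  using holomorphic_derivI[OF mat_holomorphic_onD[OF assms] S] by (simp add: mat_deriv_def)

lemma mat_deriv_eqI:
  assumes "\<And>i j. ((\<lambda>w. F w $ i $ j) has_field_derivative D $ i $ j) (at z)"
  shows "mat_deriv F z = D"
  using assms by (auto simp: vec_eq_iff mat_deriv_def intro!: DERIV_imp_deriv)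

lemma mat_deriv_add:
  assumes "mat_holomorphic_on F S" "mat_holomorphic_on G S"
  shows "mat_deriv (\<lambda>w. F w + G w) z = mat_deriv F z + mat_deriv G z"
  by (rule mat_deriv_eqI)
     (auto intro!: derivative_eq_intros has_field_derivative_mat_deriv assms)

lemma mat_deriv_mult:
  assumes "mat_holomorphic_on F S" "mat_holomorphic_on G S"
  shows "mat_deriv (\<lambda>w. F w ** G w) z = mat_deriv F z ** G z + F z ** mat_deriv G z"
  by (rule mat_deriv_eqI)
     (auto simp: matrix_matrix_mult_def sum.distrib[symmetric] mult_ac
       intro!: derivative_eq_intros has_field_derivative_mat_deriv assms)

lemma mat_deriv_smult_id:
  assumes "mat_holomorphic_on F S"
  shows "mat_deriv (\<lambda>w. w \<cdot>\<^sub>m F w) z = F z + z \<cdot>\<^sub>m mat_deriv F z"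
  by (rule mat_deriv_eqI)
     (auto intro!: derivative_eq_intros has_field_derivative_mat_deriv assms)

lemma mat_deriv_transpose:
  assumes "mat_holomorphic_on F S"
  shows "mat_deriv (\<lambda>w. transpose (F w)) z = transpose (mat_deriv F z)"
  by (rule mat_deriv_eqI)
     (auto simp: transpose_def intro!: has_field_derivative_mat_deriv assms)

lemma mat_deriv_block_diag:
  assumes A: "mat_holomorphic_on A S" and D: "mat_holomorphic_on D S"
  shows "mat_deriv (\<lambda>w. block_diag (A w) (D w)) z = block_diag (mat_deriv A z) (mat_deriv D z)"
proof (rule mat_deriv_eqI)
  fix i j :: "'a + 'a"
  show "((\<lambda>w. block_diag (A w) (D w) $ i $ j) has_field_derivative
      block_diag (mat_deriv A z) (mat_deriv D z) $ i $ j) (at z)"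
    using has_field_derivative_mat_deriv[OF A] has_field_derivative_mat_deriv[OF D]
    by (cases i; cases j) (simp_all add: block_mat_def)
qed

text \<open>Differentiate \<open>F ** matrix_inv F = mat 1\<close> and multiply by the inverse from
  the left.\<close>

lemma mat_deriv_matrix_inv:
  fixes F :: "complex \<Rightarrow> 'a::finite cmat"
  assumes F: "mat_holomorphic_on F S" and inv: "\<And>w. w \<in> S \<Longrightarrow> invertible (F w)"
  shows "mat_deriv (\<lambda>w. matrix_inv (F w)) z = - (matrix_inv (F z) ** mat_deriv F z ** matrix_inv (F z))"
proof -
  let ?G = "\<lambda>w. matrix_inv (F w)"
  have G: "mat_holomorphic_on ?G S" by (rule mat_holomorphic_on_matrix_inv[OF F inv])
  have "mat_deriv (\<lambda>w. F w ** ?G w) z = 0"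
  proof (rule mat_deriv_eqI)
    fix i j
    \<comment> \<open>The product is known to be the identity on \<open>S\<close> only, so the
      vanishing derivative is transferred from the constant function on this open set.\<close>
    have "((\<lambda>w. (mat 1 :: 'a cmat) $ i $ j) has_field_derivative 0 $ i $ j) (at z)" by simp
    then show "((\<lambda>w. (F w ** ?G w) $ i $ j) has_field_derivative 0 $ i $ j) (at z)"
      by (rule has_field_derivative_transform_within_open[OF _ S])
         (simp add: matrix_inv_left_right inv)
  qed
  then have "F z ** mat_deriv ?G z = - (mat_deriv F z ** ?G z)"
    by (simp add: mat_deriv_mult[OF F G] eq_neg_iff_add_eq_0 add.commute)
  then have "?G z ** (F z ** mat_deriv ?G z) = - (?G z ** mat_deriv F z ** ?G z)"
    by (simp add: matrix_mul_assoc)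
  then show ?thesis
    by (simp add: matrix_mul_assoc matrix_inv_left_right inv S)
qed

text \<open>Allows an identity that holds only on \<open>S\<close> to be differentiated; nothing is
  asked of the two functions outside \<open>S\<close>.\<close>

lemma mat_deriv_cong_open:
  assumes "\<And>w. w \<in> S \<Longrightarrow> F w = G w"
  shows "mat_deriv F z = mat_deriv G z"
proof -
  have "eventually (\<lambda>w. F w $ i $ j = G w $ i $ j) (nhds z)" for i j
    using eventually_nhds_in_open[OF S] by eventually_elim (simp add: assms)
  then show ?thesis by (auto simp: vec_eq_iff mat_deriv_def intro: deriv_cong_ev)
qed

end

subsection \<open>Structure matrices\<close>

lemma calN_block_diag:
  assumes "open S" "z \<in> S" "mat_holomorphic_on A S" "mat_holomorphic_on D S"
  shows "calN (\<lambda>w. block_diag (A w) (D w)) z = block_diag (calN A z) (calN D z)"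
  by (simp add: calN_def mat_deriv_block_diag[OF assms] block_mat_mult smult_block_mat block_mat_add)

lemma calN_transpose:
  assumes "open S" "z \<in> S" "mat_holomorphic_on F S"
  shows "calN (\<lambda>w. transpose (F w)) z = transpose (calN F z)"
  by (simp add: calN_def mat_deriv_transpose[OF assms] matrix_transpose_mul)

text \<open>For Z = Y D one has Z' Z^(-1) = Y' Y^(-1) + Y D' D^(-1) Y^(-1). After multiplication by
  z and by Y from the right, z D' D^(-1) becomes B and no factor D is left.\<close>

lemma structure_matrix_mult:
  assumes S: "open S" "z \<in> S"
    and Y: "mat_holomorphic_on Y S" "\<And>w. w \<in> S \<Longrightarrow> invertible (Y w)"
    and D: "mat_holomorphic_on D S" "\<And>w. w \<in> S \<Longrightarrow> invertible (D w)"
    and B: "\<And>w. w \<in> S \<Longrightarrow> w \<cdot>\<^sub>m mat_deriv D w = B w ** D w"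
  shows "(z \<cdot>\<^sub>m M_L (\<lambda>w. Y w ** D w) z) ** Y z = z \<cdot>\<^sub>m mat_deriv Y z + Y z ** B z"
proof -
  have inv: "matrix_inv (Y z ** D z) = matrix_inv (D z) ** matrix_inv (Y z)"
  proof (rule matrix_inv_eqI)
    have "Y z ** D z ** (matrix_inv (D z) ** matrix_inv (Y z))
        = Y z ** (D z ** matrix_inv (D z)) ** matrix_inv (Y z)"
      by (simp add: matrix_mul_assoc)
    then show "Y z ** D z ** (matrix_inv (D z) ** matrix_inv (Y z)) = mat 1"
      by (simp add: matrix_inv_left_right(1)[OF D(2)[OF S(2)]] matrix_inv_left_right(1)[OF Y(2)[OF S(2)]])
  qed
  have "(z \<cdot>\<^sub>m M_L (\<lambda>w. Y w ** D w) z) ** Y z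
      = z \<cdot>\<^sub>m mat_deriv (\<lambda>w. Y w ** D w) z ** matrix_inv (D z) ** (matrix_inv (Y z) ** Y z)"
    by (simp add: M_L_def inv matrix_mul_assoc)
  also have "\<dots> = z \<cdot>\<^sub>m (mat_deriv Y z ** D z + Y z ** mat_deriv D z) ** matrix_inv (D z)"
    by (simp add: matrix_inv_left_right(2)[OF Y(2)[OF S(2)]] mat_deriv_mult[OF S Y(1) D(1)])
  also have "\<dots> = z \<cdot>\<^sub>m mat_deriv Y z ** (D z ** matrix_inv (D z))
      + Y z ** (z \<cdot>\<^sub>m mat_deriv D z) ** matrix_inv (D z)"
    by (simp add: matrix_mul_assoc matrix_mult_add_left smult_mat_add)
  also have "\<dots> = z \<cdot>\<^sub>m mat_deriv Y z ** (D z ** matrix_inv (D z))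
      + Y z ** B z ** (D z ** matrix_inv (D z))"
    unfolding B[OF S(2)] by (simp add: matrix_mul_assoc)
  finally show ?thesis using matrix_inv_left_right(1)[OF D(2)[OF S(2)]] by simp
qed

text \<open>Differentiate \<open>M Y = z Y' + Y B\<close> with \<open>M = z Z' Z\<^sup>-\<^sup>1\<close>, and eliminate
  \<open>M Y'\<close> by multiplying the same identity by \<open>M\<close>.\<close>

lemma second_order_L:
  assumes S: "open S" "z \<in> S" "z \<noteq> 0"
    and Y: "mat_holomorphic_on Y S" "\<And>w. w \<in> S \<Longrightarrow> invertible (Y w)"
    and D: "mat_holomorphic_on D S" "\<And>w. w \<in> S \<Longrightarrow> invertible (D w)"
    and Bh: "mat_holomorphic_on B S"
    and B: "\<And>w. w \<in> S \<Longrightarrow> w \<cdot>\<^sub>m mat_deriv D w = B w ** D w"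
  shows "z \<cdot>\<^sub>m mat_deriv (mat_deriv Y) z + mat_deriv Y z ** (2 \<cdot>\<^sub>m B z + mat 1) + Y z ** calN B z
    = calN (\<lambda>w. w \<cdot>\<^sub>m M_L (\<lambda>w. Y w ** D w) w) z ** Y z"
proof -
  define M where "M = (\<lambda>w. w \<cdot>\<^sub>m M_L (\<lambda>w. Y w ** D w) w)"
  have MY: "M w ** Y w = w \<cdot>\<^sub>m mat_deriv Y w + Y w ** B w" if "w \<in> S" for w
    unfolding M_def using structure_matrix_mult[OF S(1) that Y D B] .
  have Yi: "invertible (Y w ** D w)" if "w \<in> S" for w
    using Y(2)[OF that] D(2)[OF that] by (simp add: invertible_det_nz det_mul)
  note YD = mat_holomorphic_on_mult[OF Y(1) D(1)]
  \<comment> \<open>Needed to differentiate the product M Y; it comes from the definition of M as z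
    Z' Z^(-1) with Z = Y D holomorphic and invertible.\<close>
  have M: "mat_holomorphic_on M S"
    unfolding M_def M_L_def
    by (intro mat_holomorphic_on_smult holomorphic_intros mat_holomorphic_on_mult
        mat_holomorphic_on_deriv[OF YD S(1)] mat_holomorphic_on_matrix_inv[OF YD Yi])
  note Y' = mat_holomorphic_on_deriv[OF Y(1) S(1)]
  have h: "mat_holomorphic_on (\<lambda>w. w \<cdot>\<^sub>m mat_deriv Y w) S"
    "mat_holomorphic_on (\<lambda>w. Y w ** B w) S"
    by (intro mat_holomorphic_on_smult mat_holomorphic_on_mult holomorphic_intros Y' Y Bh)+
  have "mat_deriv (\<lambda>w. M w ** Y w) z = mat_deriv (\<lambda>w. w \<cdot>\<^sub>m mat_deriv Y w + Y w ** B w) z"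
    by (rule mat_deriv_cong_open[OF S(1,2) MY])
  then have 1: "mat_deriv M z ** Y z = mat_deriv Y z + z \<cdot>\<^sub>m mat_deriv (mat_deriv Y) z
      + mat_deriv Y z ** B z + Y z ** mat_deriv B z - M z ** mat_deriv Y z"
    by (simp add: mat_deriv_mult[OF S(1,2)] M Y Bh mat_deriv_add[OF S(1,2) h]
          mat_deriv_smult_id[OF S(1,2) Y'] algebra_simps)
  \<comment> \<open>Using the first order identity twice turns M^2 Y into z M Y' + (z Y' + Y B) B.
    Divided by z, its term M Y' cancels the one subtracted in \<open>1\<close>.\<close>
  have "M z ** (M z ** Y z) = z \<cdot>\<^sub>m (M z ** mat_deriv Y z) + (M z ** Y z) ** B z"
    unfolding MY[OF S(2)]
    by (simp add: matrix_add_ldistrib matrix_mul_assoc MY[OF S(2)])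
  also have "\<dots> = z \<cdot>\<^sub>m (M z ** mat_deriv Y z + mat_deriv Y z ** B z) + Y z ** B z ** B z"
    unfolding MY[OF S(2)] by (simp add: matrix_mult_add_left smult_mat_add)
  finally have 2: "(1 / z) \<cdot>\<^sub>m (M z ** M z ** Y z)
      = M z ** mat_deriv Y z + mat_deriv Y z ** B z + (1 / z) \<cdot>\<^sub>m (Y z ** B z ** B z)"
    using S(3) by (simp add: smult_mat_add matrix_mul_assoc)
  \<comment> \<open>The coefficient 2 B + 1 of Y' has three sources: one B from differentiating Y B,
    one B from \<open>2\<close>, and the identity from differentiating z Y'.\<close>
  have two: "2 \<cdot>\<^sub>m A = A + A" for A :: "'a cmat" by (simp add: vec_eq_iff)
  have "calN M z ** Y z = mat_deriv M z ** Y z + (1 / z) \<cdot>\<^sub>m (M z ** M z ** Y z)"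
    by (simp add: calN_def matrix_mult_add_left)
  also have "\<dots> = z \<cdot>\<^sub>m mat_deriv (mat_deriv Y) z + mat_deriv Y z ** (2 \<cdot>\<^sub>m B z + mat 1) + Y z ** calN B z"
    unfolding 1 2 calN_def two
    by (simp only: matrix_add_ldistrib matrix_mul_assoc matrix_mul_rid smult_mat_mult_right)
       (simp add: algebra_simps)
  finally show ?thesis by (simp add: M_def)
qed

text \<open>Transposition reverses products, so the transposes of Y, D and B satisfy the hypotheses
  of \<open>second_order_L\<close>, and the left structure matrix of the transpose of D Y is the
  transpose of the right structure matrix of D Y.\<close>

lemma second_order_R:
  assumes S: "open S" "z \<in> S" "z \<noteq> 0"
    and Y: "mat_holomorphic_on Y S" "\<And>w. w \<in> S \<Longrightarrow> invertible (Y w)"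
    and D: "mat_holomorphic_on D S" "\<And>w. w \<in> S \<Longrightarrow> invertible (D w)"
    and Bh: "mat_holomorphic_on B S"
    and B: "\<And>w. w \<in> S \<Longrightarrow> w \<cdot>\<^sub>m mat_deriv D w = D w ** B w"
  shows "z \<cdot>\<^sub>m mat_deriv (mat_deriv Y) z + (2 \<cdot>\<^sub>m B z + mat 1) ** mat_deriv Y z + calN B z ** Y z
    = Y z ** calN (\<lambda>w. w \<cdot>\<^sub>m M_R (\<lambda>w. D w ** Y w) w) z"
proof -
  let ?M = "\<lambda>w. w \<cdot>\<^sub>m M_R (\<lambda>w. D w ** Y w) w"
  have inv: "invertible (D w ** Y w)" if "w \<in> S" for w
    using Y(2)[OF that] D(2)[OF that] by (simp add: invertible_det_nz det_mul)
  note DY = mat_holomorphic_on_mult[OF D(1) Y(1)]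
  have M: "mat_holomorphic_on ?M S"
    unfolding M_R_def
    by (intro mat_holomorphic_on_smult holomorphic_intros mat_holomorphic_on_mult
        mat_holomorphic_on_deriv[OF DY S(1)] mat_holomorphic_on_matrix_inv[OF DY inv])
  have struct_eq: "M_L (\<lambda>w. transpose (Y w) ** transpose (D w)) w = transpose (M_R (\<lambda>w. D w ** Y w) w)"
    if "w \<in> S" for w
    unfolding M_L_def M_R_def matrix_transpose_mul[symmetric]
      mat_deriv_transpose[OF S(1) that DY] matrix_inv_transpose[OF inv[OF that]] ..
  let ?L = "\<lambda>w. w \<cdot>\<^sub>m M_L (\<lambda>w. transpose (Y w) ** transpose (D w)) w"
  have L: "?L w = transpose (?M w)" if "w \<in> S" for w
    by (simp only: struct_eq[OF that] transpose_smult_mat)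
  \<comment> \<open>\<open>L\<close> is available on \<open>S\<close> only, and \<open>calN\<close>
    contains a derivative; openness of \<open>S\<close> makes this enough. The same applies to the
    inner derivative in \<open>Y2\<close>.\<close>
  have "calN ?L z = calN (\<lambda>w. transpose (?M w)) z"
  proof -
    have "mat_deriv ?L z = mat_deriv (\<lambda>w. transpose (?M w)) z"
      by (rule mat_deriv_cong_open[OF S(1,2)]) (rule L)
    then show ?thesis by (simp only: calN_def L[OF S(2)])
  qed
  then have N: "calN ?L z = transpose (calN ?M z)"
    by (simp only: calN_transpose[OF S(1,2) M])
  have Y2: "mat_deriv (mat_deriv (\<lambda>w. transpose (Y w))) z = transpose (mat_deriv (mat_deriv Y) z)"
  proof -
    have "mat_deriv (mat_deriv (\<lambda>w. transpose (Y w))) z = mat_deriv (\<lambda>w. transpose (mat_deriv Y w)) z"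
      by (rule mat_deriv_cong_open[OF S(1,2)]) (rule mat_deriv_transpose[OF S(1) _ Y(1)])
    then show ?thesis
      by (simp only: mat_deriv_transpose[OF S(1,2) mat_holomorphic_on_deriv[OF Y(1) S(1)]])
  qed
  have B': "w \<cdot>\<^sub>m mat_deriv (\<lambda>w. transpose (D w)) w = transpose (B w) ** transpose (D w)"
    if "w \<in> S" for w
    unfolding mat_deriv_transpose[OF S(1) that D(1)] matrix_transpose_mul[symmetric] B[OF that, symmetric]
    by simp
  have "z \<cdot>\<^sub>m mat_deriv (mat_deriv (\<lambda>w. transpose (Y w))) z
      + mat_deriv (\<lambda>w. transpose (Y w)) z ** (2 \<cdot>\<^sub>m transpose (B z) + mat 1)
      + transpose (Y z) ** calN (\<lambda>w. transpose (B w)) z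
    = calN (\<lambda>w. w \<cdot>\<^sub>m M_L (\<lambda>w. transpose (Y w) ** transpose (D w)) w) z ** transpose (Y z)"
    by (rule second_order_L[OF S])
      (use Y D Bh B' in \<open>simp_all add: mat_holomorphic_on_transpose invertible_transpose_field\<close>)
  then have "transpose (z \<cdot>\<^sub>m mat_deriv (mat_deriv Y) z + (2 \<cdot>\<^sub>m B z + mat 1) ** mat_deriv Y z
        + calN B z ** Y z)
      = transpose (Y z ** calN ?M z)"
    by (simp only: N Y2 mat_deriv_transpose[OF S(1,2) Y(1)] calN_transpose[OF S(1,2) Bh]
          matrix_transpose_mul transpose_add transpose_smult_mat transpose_mat)
  then show ?thesis by (simp only: transpose_iff)
qed

text \<open>In (V^(-1))' = -V^(-1) V' V^(-1) the equation z V' = V k lets the left factor V^(-1)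
  cancel, which gives z (V^(-1))' = -k V^(-1). This is the origin of the block -h^R.\<close>

lemma pearson_block_L:
  assumes S: "open S" "z \<in> S"
    and U: "mat_holomorphic_on U S" "z \<cdot>\<^sub>m mat_deriv U z = h ** U z"
    and V: "mat_holomorphic_on V S" "\<And>w. w \<in> S \<Longrightarrow> invertible (V w)" "z \<cdot>\<^sub>m mat_deriv V z = V z ** k"
  shows "z \<cdot>\<^sub>m mat_deriv (\<lambda>w. block_diag (U w) (matrix_inv (V w))) z
    = block_diag h (- k) ** block_diag (U z) (matrix_inv (V z))"
proof -
  have "z \<cdot>\<^sub>m mat_deriv (\<lambda>w. matrix_inv (V w)) z
      = - (matrix_inv (V z) ** (z \<cdot>\<^sub>m mat_deriv V z) ** matrix_inv (V z))"
    by (simp add: mat_deriv_matrix_inv[OF S V(1,2)])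
  also have "\<dots> = - k ** matrix_inv (V z)"
    unfolding V(3) by (simp add: matrix_mul_assoc matrix_inv_left_right[OF V(2)[OF S(2)]])
  finally show ?thesis
    using mat_deriv_block_diag[OF S U(1) mat_holomorphic_on_matrix_inv[OF V(1,2)]] U(2)
    by (simp add: block_mat_mult smult_block_mat)
qed

text \<open>The mirror image: for z V' = k V the right factor V^(-1) cancels, and -k ends up to the
  right of V^(-1).\<close>

lemma pearson_block_R:
  assumes S: "open S" "z \<in> S"
    and U: "mat_holomorphic_on U S" "z \<cdot>\<^sub>m mat_deriv U z = U z ** h"
    and V: "mat_holomorphic_on V S" "\<And>w. w \<in> S \<Longrightarrow> invertible (V w)" "z \<cdot>\<^sub>m mat_deriv V z = k ** V z"
  shows "z \<cdot>\<^sub>m mat_deriv (\<lambda>w. block_diag (U w) (matrix_inv (V w))) z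
    = block_diag (U z) (matrix_inv (V z)) ** block_diag h (- k)"
proof -
  have "z \<cdot>\<^sub>m mat_deriv (\<lambda>w. matrix_inv (V w)) z
      = - (matrix_inv (V z) ** (z \<cdot>\<^sub>m mat_deriv V z) ** matrix_inv (V z))"
    by (simp add: mat_deriv_matrix_inv[OF S V(1,2)])
  also have "\<dots> = - (matrix_inv (V z) ** k ** (V z ** matrix_inv (V z)))"
    unfolding V(3) by (simp add: matrix_mul_assoc)
  finally show ?thesis
    using mat_deriv_block_diag[OF S U(1) mat_holomorphic_on_matrix_inv[OF V(1,2)]] U(2)
    by (simp add: block_mat_mult smult_block_mat matrix_inv_left_right[OF V(2)[OF S(2)]])
qed

subsection \<open>Integrals along the curve\<close>

text \<open>A convergent sequence is bounded. Since the curve tends to infinity, the parameters of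
  such a sequence stay in a compact interval, whose image is compact.\<close>

lemma curve_set_closed:
  assumes "continuous_on {0..} g" "filterlim g at_infinity at_top"
  shows "closed (curve_set g)"
  unfolding closed_sequential_limits
proof (intro allI impI)
  fix x l assume "(\<forall>n. x n \<in> curve_set g) \<and> x \<longlonglongrightarrow> l"
  then have x: "\<And>n. x n \<in> curve_set g" "x \<longlonglongrightarrow> l" by auto
  obtain R where R: "\<And>n. norm (x n) \<le> R"
    using convergent_imp_Bseq[OF convergentI[OF x(2)]] by (auto simp: Bseq_def)
  have "\<forall>\<^sub>F t in at_top. norm (g t) \<ge> R + 1"
    using filterlim_at_infinity_imp_norm_at_top[OF assms(2)] by (simp add: filterlim_at_top)
  then obtain T where T: "\<And>t. t \<ge> T \<Longrightarrow> norm (g t) \<ge> R + 1"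
    by (auto simp: eventually_at_top_linorder)
  have "x n \<in> g ` {0..T}" for n
  proof -
    obtain t where t: "t \<ge> 0" "x n = g t" using x(1)[of n] by (auto simp: curve_set_def)
    with T[of t] R[of n] have "t \<le> T" by (cases "T \<le> t") auto
    with t show ?thesis by auto
  qed
  moreover have "closed (g ` {0..T})"
    by (intro compact_imp_closed compact_continuous_image continuous_on_subset[OF assms(1)]) auto
  ultimately have "l \<in> g ` {0..T}" using closed_sequentially[of "g ` {0..T}" x l] x(2) by blast
  then show "l \<in> curve_set g" by (auto simp: curve_set_def)
qed

text \<open>Entries are bounded linear images of the matrix; conversely the matrix is a finite sum
  of bounded linear images of its entries.\<close>

lemma integrable_mat_iff:
  fixes f :: "'a \<Rightarrow> complex ^ 'n::finite ^ 'm::finite"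
  shows "integrable M f \<longleftrightarrow> (\<forall>i j. integrable M (\<lambda>t. f t $ i $ j))"
proof safe
  fix i j assume "integrable M f"
  then show "integrable M (\<lambda>t. f t $ i $ j)"
    by (rule integrable_bounded_linear[rotated])
       (intro bounded_linear_compose[OF bounded_linear_vec_nth bounded_linear_vec_nth])
next
  assume *: "\<forall>i j. integrable M (\<lambda>t. f t $ i $ j)"
  \<comment> \<open>\<open>E i j x\<close> is \<open>x\<close> times the elementary matrix at
    position (i, j).\<close>
  define E where "E = (\<lambda>i j x. (\<chi> a b. if a = i \<and> b = j then x else 0) :: complex^'n^'m)"
  have "linear (E i j)" for i j
    by (rule linearI) (auto simp: E_def vec_eq_iff)
  then have E: "bounded_linear (E i j)" for i j
    by (rule linear_conv_bounded_linear[THEN iffD1])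
  then have "integrable M (\<lambda>t. \<Sum>i\<in>UNIV. \<Sum>j\<in>UNIV. E i j (f t $ i $ j))"
    using * by (intro Bochner_Integration.integrable_sum integrable_bounded_linear[OF E]) blast
  moreover have "(\<Sum>i\<in>UNIV. \<Sum>j\<in>UNIV. E i j (f t $ i $ j)) = f t" for t
  proof -
    have E_nth: "E i j x $ a $ b = (if a = i then (if b = j then x else 0) else 0)" for i j x a b
      by (simp add: E_def)
    have "(\<Sum>i\<in>UNIV. \<Sum>j\<in>UNIV. E i j (f t $ i $ j)) $ a $ b = f t $ a $ b" for a b
    proof -
      have "(\<Sum>j\<in>UNIV. E i j (f t $ i $ j) $ a $ b) = (if a = i then f t $ i $ b else 0)" for i
        by (cases "a = i") (simp_all add: E_nth)
      then show ?thesis by (simp add: sum_component)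
    qed
    then show ?thesis by (simp add: vec_eq_iff)
  qed
  ultimately show "integrable M f" by simp
qed

lemma curve_integrable_iff:
  "curve_integrable g F \<longleftrightarrow>
    (\<forall>i j. set_integrable lborel {0<..} (\<lambda>t. vector_derivative g (at t) * F (g t) $ i $ j))"
  by (simp add: curve_integrable_def set_integrable_def integrable_mat_iff)

lemma curve_integral_nth:
  assumes "curve_integrable g F"
  shows "curve_integral g F $ i $ j
    = set_lebesgue_integral lborel {0<..} (\<lambda>t. vector_derivative g (at t) * F (g t) $ i $ j)"
proof -
  have "bounded_linear (\<lambda>A :: 'a cmat. A $ i $ j)"
    by (intro bounded_linear_compose[OF bounded_linear_vec_nth bounded_linear_vec_nth])
  from integral_bounded_linear[OF this assms[unfolded curve_integrable_def set_integrable_def]]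
  show ?thesis by (simp add: curve_integral_def set_lebesgue_integral_def)
qed

lemma curve_integral_cong:
  assumes "\<And>z. z \<in> curve_set g \<Longrightarrow> F z = G z"
  shows "curve_integrable g F \<longleftrightarrow> curve_integrable g G"
    and "curve_integral_2pii g F = curve_integral_2pii g G"
proof -
  have "F (g t) = G (g t)" if "t \<in> {0<..}" for t
    using that by (auto intro!: assms simp: curve_set_def)
  then have eq: "vector_derivative g (at t) \<cdot>\<^sub>m F (g t) = vector_derivative g (at t) \<cdot>\<^sub>m G (g t)"
    if "t \<in> {0<..}" for t using that by simp
  show "curve_integrable g F \<longleftrightarrow> curve_integrable g G"
    unfolding curve_integrable_def by (rule set_integrable_cong[OF refl refl eq])
  show "curve_integral_2pii g F = curve_integral_2pii g G"
    unfolding curve_integral_2pii_def curve_integral_def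
    by (rule arg_cong[where f = "smult_mat _"], rule set_lebesgue_integral_cong) (use eq in auto)
qed

text \<open>\<open>linear\<close> means real linearity, which commutes with the Bochner integral.
  Complex homogeneity is asked for separately, to move \<open>T\<close> past the complex factors g'
  and 1/(2 pi i).\<close>

lemma curve_integral_linear:
  fixes T :: "'n::finite cmat \<Rightarrow> 'n cmat"
  assumes T: "linear T" "\<And>c A. T (c \<cdot>\<^sub>m A) = c \<cdot>\<^sub>m T A" and F: "curve_integrable g F"
  shows "curve_integrable g (\<lambda>z. T (F z))"
    and "curve_integral_2pii g (\<lambda>z. T (F z)) = T (curve_integral_2pii g F)"
proof -
  have bl: "bounded_linear T" using T(1) by (rule linear_conv_bounded_linear[THEN iffD1])
  note F' = F[unfolded curve_integrable_def set_integrable_def]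
  have *: "T (r *\<^sub>R c \<cdot>\<^sub>m A) = r *\<^sub>R c \<cdot>\<^sub>m T A" for r c A
    using T by (simp add: linear_scale)
  show "curve_integrable g (\<lambda>z. T (F z))"
    using integrable_bounded_linear[OF bl F']
    by (simp add: curve_integrable_def set_integrable_def *)
  show "curve_integral_2pii g (\<lambda>z. T (F z)) = T (curve_integral_2pii g F)"
    using integral_bounded_linear[OF bl F']
    by (simp add: curve_integral_2pii_def curve_integral_def set_lebesgue_integral_def * T(2))
qed

lemma linear_matrix_mult:
  fixes A :: "'n::finite cmat"
  shows "linear (\<lambda>X :: 'n cmat. A ** X)" "linear (\<lambda>X :: 'n cmat. X ** A)"
  by (auto intro!: linearI simp: matrix_add_ldistrib matrix_mult_add_left matrix_scalar_ac scalar_matrix_assoc)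

lemmas curve_integral_mult_left =
    curve_integral_linear[where T = "\<lambda>X. A ** X" for A, OF linear_matrix_mult(1) smult_mat_mult_right]
  and curve_integral_mult_right =
    curve_integral_linear[where T = "\<lambda>X. X ** A" for A, OF linear_matrix_mult(2) smult_mat_mult_left]

lemma curve_integral_add:
  assumes "curve_integrable g F" "curve_integrable g G"
  shows "curve_integrable g (\<lambda>z. F z + G z)"
    and "curve_integral_2pii g (\<lambda>z. F z + G z) = curve_integral_2pii g F + curve_integral_2pii g G"
  using set_integral_add[OF assms[unfolded curve_integrable_def]]
  by (simp_all add: curve_integrable_def curve_integral_2pii_def curve_integral_def smult_mat_add)

lemma curve_integral_diff:
  assumes "curve_integrable g F" "curve_integrable g G"
  shows "curve_integrable g (\<lambda>z. F z - G z)"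
    and "curve_integral_2pii g (\<lambda>z. F z - G z) = curve_integral_2pii g F - curve_integral_2pii g G"
  using set_integral_diff[OF assms[unfolded curve_integrable_def]]
  by (simp_all add: curve_integrable_def curve_integral_2pii_def curve_integral_def smult_mat_diff)

lemma curve_integral_sum:
  fixes F :: "'k \<Rightarrow> complex \<Rightarrow> 'n::finite cmat"
  assumes "finite I" "\<And>k. k \<in> I \<Longrightarrow> curve_integrable g (F k)"
  shows "curve_integrable g (\<lambda>z. \<Sum>k\<in>I. F k z) \<and>
    curve_integral_2pii g (\<lambda>z. \<Sum>k\<in>I. F k z) = (\<Sum>k\<in>I. curve_integral_2pii g (F k))"
  using assms
proof (induction I rule: finite_induct)
  case empty
  have "0 \<cdot>\<^sub>m (0 :: 'n cmat) = 0" by (simp add: vec_eq_iff)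
  then show ?case
    by (simp add: curve_integrable_def curve_integral_2pii_def curve_integral_def
        set_integrable_def set_lebesgue_integral_def)
next
  case (insert k I)
  then show ?case using curve_integral_add[of g "F k" "\<lambda>z. \<Sum>k\<in>I. F k z"] by auto
qed

text \<open>Continuity of the multiplier along the curve gives measurability, and domination by a
  constant multiple of the old integrand gives integrability.\<close>

lemma curve_integrable_bounded_mult:
  fixes F :: "complex \<Rightarrow> 'n::finite cmat"
  assumes F: "curve_integrable g F" and cont: "continuous_on {0<..} (\<lambda>t. \<phi> (g t))"
    and bound: "\<And>t. t > 0 \<Longrightarrow> cmod (\<phi> (g t)) \<le> K"
  shows "curve_integrable g (\<lambda>z. \<phi> z \<cdot>\<^sub>m F z)"
  unfolding curve_integrable_iff
proof (intro allI)
  fix i j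
  let ?f = "\<lambda>t. vector_derivative g (at t) * F (g t) $ i $ j"
  have f: "integrable lborel (\<lambda>t. indicator {0<..} t *\<^sub>R ?f t)"
    using F by (simp add: curve_integrable_iff set_integrable_def)
  have "(\<lambda>t. (indicator {0<..} t *\<^sub>R \<phi> (g t)) * (indicator {0<..} t *\<^sub>R ?f t)) \<in> borel_measurable lborel"
    using borel_measurable_continuous_on_indicator[OF _ cont] borel_measurable_integrable[OF f]
    by (intro borel_measurable_times) auto
  moreover have "(\<lambda>t. (indicator {0<..} t *\<^sub>R \<phi> (g t)) * (indicator {0<..} t *\<^sub>R ?f t))
     = (\<lambda>t. indicator {0<..} t *\<^sub>R (vector_derivative g (at t) * (\<phi> (g t) \<cdot>\<^sub>m F (g t)) $ i $ j))"
    by (auto simp: indicator_def fun_eq_iff)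
  ultimately have meas: "(\<lambda>t. indicator {0<..} t *\<^sub>R (vector_derivative g (at t) * (\<phi> (g t) \<cdot>\<^sub>m F (g t)) $ i $ j))
      \<in> borel_measurable lborel" by simp
  show "set_integrable lborel {0<..}
      (\<lambda>t. vector_derivative g (at t) * (\<phi> (g t) \<cdot>\<^sub>m F (g t)) $ i $ j)"
    unfolding set_integrable_def
  proof (rule Bochner_Integration.integrable_bound[OF integrable_mult_right[OF f, of "complex_of_real K"] meas],
      intro always_eventually allI)
    fix t
    show "norm (indicator {0<..} t *\<^sub>R (vector_derivative g (at t) * (\<phi> (g t) \<cdot>\<^sub>m F (g t)) $ i $ j))
      \<le> norm (complex_of_real K * (indicator {0<..} t *\<^sub>R ?f t))"
    proof (cases "t > 0")
      case True
      \<comment> \<open>The absolute value is the norm of the complex number \<open>K\<close> in the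
        dominating function; no sign of \<open>K\<close> is assumed.\<close>
      have "cmod (\<phi> (g t)) * cmod (?f t) \<le> \<bar>K\<bar> * cmod (?f t)"
        using bound[OF True] by (intro mult_right_mono) auto
      with True show ?thesis by (simp add: norm_mult mult_ac)
    qed simp
  qed
qed

section \<open>Cauchy transforms off the curve\<close>

lemma difference_quotient_inverse:
  fixes a b c :: complex
  assumes "a \<noteq> 0" "b \<noteq> 0" "a - b \<noteq> 0"
  shows "(c / b - c / a) / (a - b) - c / a ^ 2 = (a - b) * (c / (a ^ 2 * b ^ 1))"
proof -
  have "c / b - c / a = (a - b) * (c / (a * b))"
    using assms(1,2) by (simp add: field_simps)
  then have *: "(c / b - c / a) / (a - b) = c / (a * b)"
    using assms(3) by simp
  show ?thesis
    unfolding * using assms(1,2) by (simp add: field_simps power2_eq_square)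
qed

lemma cauchy_transform_holomorphic:
  fixes f u :: "'a \<Rightarrow> complex"
  assumes f: "integrable M f" and u: "u \<in> borel_measurable M"
    and K: "closed K" "\<And>t. f t \<noteq> 0 \<Longrightarrow> u t \<in> K"
  shows "(\<lambda>z. \<integral>t. f t / (u t - z) \<partial>M) holomorphic_on - K"
proof (rule holomorphic_onI)
  fix z assume z: "z \<in> - K"
  obtain e' where "e' > 0" "ball z e' \<subseteq> - K"
    using K(1) z by (meson open_Compl open_contains_ball)
  \<comment> \<open>Half the radius: by the triangle inequality every \<open>w\<close> within
    \<open>e\<close> of \<open>z\<close> still has distance at least \<open>e\<close> from all
    relevant \<open>u t\<close>.\<close>
  define e where "e = e' / 2"
  have e: "e > 0" "\<And>w t. dist z w < e \<Longrightarrow> f t \<noteq> 0 \<Longrightarrow> e \<le> cmod (u t - w)"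
  proof -
    show "e > 0" using \<open>e' > 0\<close> by (simp add: e_def)
    fix w t assume *: "dist z w < e" "f t \<noteq> 0"
    then have "u t \<notin> ball z e'" using K(2) \<open>ball z e' \<subseteq> - K\<close> by auto
    then have "2 * e \<le> dist z (u t)" by (simp add: e_def)
    also have "\<dots> \<le> dist z w + dist w (u t)" by (rule dist_triangle)
    finally show "e \<le> cmod (u t - w)" using * by (simp add: dist_norm norm_minus_commute)
  qed
  \<comment> \<open>One statement for all exponents: (0,1) and (1,0) are the two Cauchy kernels,
    (2,0) is the derivative kernel and (2,1) the error term.\<close>
  have int: "integrable M (\<lambda>t. f t / ((u t - z) ^ k * (u t - w) ^ l))" if "dist z w < e" for k l w
  proof (rule Bochner_Integration.integrable_bound[OF integrable_mult_right[OF f, of "complex_of_real (1 / e ^ (k + l))"]])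
    show "(\<lambda>t. f t / ((u t - z) ^ k * (u t - w) ^ l)) \<in> borel_measurable M"
      using u borel_measurable_integrable[OF f] by measurable
    have "norm (f t / ((u t - z) ^ k * (u t - w) ^ l)) \<le> norm (complex_of_real (1 / e ^ (k + l)) * f t)"
      for t
    proof (cases "f t = 0")
      case False
      have "e ^ k * e ^ l \<le> cmod (u t - z) ^ k * cmod (u t - w) ^ l"
        using e(2)[OF _ False, of z] e(2)[OF that False] e(1) by (intro mult_mono power_mono) auto
      then have "cmod (f t) / (cmod (u t - z) ^ k * cmod (u t - w) ^ l) \<le> cmod (f t) / (e ^ k * e ^ l)"
        using e(1) by (intro frac_le) auto
      then show ?thesis using e(1) by (simp add: norm_divide norm_mult norm_power power_add)
    qed simp
    then show "AE t in M. norm (f t / ((u t - z) ^ k * (u t - w) ^ l))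
        \<le> norm (complex_of_real (1 / e ^ (k + l)) * f t)" by simp
  qed
  let ?F = "\<lambda>z. \<integral>t. f t / (u t - z) \<partial>M"
  define D where "D = (\<integral>t. f t / (u t - z) ^ 2 \<partial>M)"
  \<comment> \<open>The error kernel has three factors in its denominator, each of modulus at least
    \<open>e\<close>; hence the third power.\<close>
  define L where "L = (\<integral>t. cmod (f t) \<partial>M) / e ^ 3"
  have "cmod ((?F w - ?F z) / (w - z) - D) \<le> cmod (w - z) * L" if "w \<noteq> z" "dist z w < e" for w
  proof -
    have "(?F w - ?F z) / (w - z) - D
        = (\<integral>t. (f t / (u t - w) - f t / (u t - z)) / (w - z) - f t / (u t - z) ^ 2 \<partial>M)"
      using int[OF that(2), of 0 1] int[of z 1 0] int[of z 2 0] e(1) by (simp add: D_def)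
    \<comment> \<open>Pointwise this is \<open>difference_quotient_inverse\<close> for u - z and u -
      w; the exponent 1 keeps the shape of \<open>int\<close>.\<close>
    also have "\<dots> = (\<integral>t. (w - z) * (f t / ((u t - z) ^ 2 * (u t - w) ^ 1)) \<partial>M)"
    proof (intro Bochner_Integration.integral_cong refl)
      fix t
      show "(f t / (u t - w) - f t / (u t - z)) / (w - z) - f t / (u t - z) ^ 2
          = (w - z) * (f t / ((u t - z) ^ 2 * (u t - w) ^ 1))"
      proof (cases "f t = 0")
        case False
        then have "u t - w \<noteq> 0" "u t - z \<noteq> 0" using e(2)[OF that(2) False] e(2)[of z t] e(1) by auto
        moreover have "w - z \<noteq> 0" using that by simp
        ultimately show ?thesis
          using difference_quotient_inverse[of "u t - z" "u t - w" "f t"] by simp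
      qed simp
    qed
    also have "cmod \<dots> = cmod (w - z) * cmod (\<integral>t. f t / ((u t - z) ^ 2 * (u t - w) ^ 1) \<partial>M)"
      by (simp only: integral_mult_right_zero norm_mult)
    also have "cmod (\<integral>t. f t / ((u t - z) ^ 2 * (u t - w) ^ 1) \<partial>M) \<le> (\<integral>t. cmod (f t) / e ^ 3 \<partial>M)"
    proof (rule order_trans[OF integral_norm_bound integral_mono])
      show "integrable M (\<lambda>t. cmod (f t / ((u t - z) ^ 2 * (u t - w) ^ 1)))"
        by (rule integrable_norm[OF int[OF that(2), of 2 1]])
      show "integrable M (\<lambda>t. cmod (f t) / e ^ 3)" using f by simp
      fix t
      show "cmod (f t / ((u t - z) ^ 2 * (u t - w) ^ 1)) \<le> cmod (f t) / e ^ 3"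
      proof (cases "f t = 0")
        case False
        have "e ^ 2 * e \<le> cmod (u t - z) ^ 2 * cmod (u t - w)"
          using e(2)[OF _ False, of z] e(2)[OF that(2) False] e(1) by (intro mult_mono power_mono) auto
        then have "cmod (f t) / (cmod (u t - z) ^ 2 * cmod (u t - w)) \<le> cmod (f t) / (e ^ 2 * e)"
          using e(1) by (intro frac_le) auto
        then show ?thesis by (simp add: norm_divide norm_mult norm_power eval_nat_numeral mult_ac)
      qed simp
    qed
    also have "\<dots> = L" by (simp add: L_def)
    finally show ?thesis by (simp add: mult_left_mono)
  qed
  then have "\<forall>\<^sub>F w in at z. cmod ((?F w - ?F z) / (w - z) - D) \<le> cmod (w - z) * L"
    unfolding eventually_at by (intro exI[of _ e]) (auto simp: e dist_commute)
  moreover have "((\<lambda>w. cmod (w - z) * L) \<longlongrightarrow> 0) (at z)"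
    by (rule tendsto_eq_intros refl | simp)+
  ultimately have "((\<lambda>w. (?F w - ?F z) / (w - z) - D) \<longlongrightarrow> 0) (at z)"
    by (rule Lim_null_comparison)
  then have "(?F has_field_derivative D) (at z)"
    by (simp add: has_field_derivative_iff LIM_zero_iff)
  then show "?F field_differentiable at z within - K"
    using field_differentiable_at_within field_differentiable_def by blast
qed

text \<open>A point off the closed curve has a positive distance \<open>e\<close> from it, so the
  kernel is bounded by 1/e along the curve.\<close>

lemma curve_integrable_cauchy_kernel:
  assumes g: "continuous_on {0..} g" "closed (curve_set g)" and z: "z \<notin> curve_set g"
    and F: "curve_integrable g F"
  shows "curve_integrable g (\<lambda>w. (1 / (w - z)) \<cdot>\<^sub>m F w)"
proof -
  obtain e where e: "e > 0" "ball z e \<subseteq> - curve_set g"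
    using g(2) z by (metis ComplI open_Compl open_contains_ball)
  have far: "e \<le> cmod (g t - z)" if "t > 0" for t
  proof -
    have "g t \<in> curve_set g" using that by (auto simp: curve_set_def)
    then have "g t \<notin> ball z e" using e(2) by auto
    then show ?thesis by (simp add: dist_norm norm_minus_commute)
  qed
  show ?thesis
  proof (rule curve_integrable_bounded_mult[OF F])
    show "continuous_on {0<..} (\<lambda>t. 1 / (g t - z))"
      using far e(1) by (intro continuous_intros continuous_on_subset[OF g(1)]) force+
    fix t :: real assume "t > 0"
    from far[OF this] e(1) have "1 / cmod (g t - z) \<le> 1 / e" by (intro divide_left_mono mult_pos_pos) auto
    then show "cmod (1 / (g t - z)) \<le> 1 / e" by (simp add: norm_divide)
  qed
qed

lemma mat_holomorphic_on_cauchy_transform: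
  assumes g: "continuous_on {0..} g" "closed (curve_set g)" and F: "curve_integrable g F"
  shows "mat_holomorphic_on (\<lambda>z. curve_integral_2pii g (\<lambda>w. (1 / (w - z)) \<cdot>\<^sub>m F w)) (- curve_set g)"
proof (rule mat_holomorphic_onI)
  fix i j
  let ?f = "\<lambda>t. indicator {0<..} t *\<^sub>R (vector_derivative g (at t) * F (g t) $ i $ j)"
  \<comment> \<open>Both functions are extended by 0 to the whole line. Where \<open>?f\<close> is
    nonzero the parameter is positive, and there \<open>?u t\<close> is the curve point
    \<open>g t\<close>.\<close>
  let ?u = "\<lambda>t. indicator {0<..} t *\<^sub>R g t"
  have f: "integrable lborel ?f"
    using F by (simp add: curve_integrable_iff set_integrable_def)
  have "continuous_on {0<..} g" by (rule continuous_on_subset[OF g(1)]) auto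
  then have u: "?u \<in> borel_measurable lborel"
    using borel_measurable_continuous_on_indicator[of "{0<..}" g] by simp
  have "(\<lambda>z. \<integral>t. ?f t / (?u t - z) \<partial>lborel) holomorphic_on - curve_set g"
    by (rule cauchy_transform_holomorphic[OF f u g(2)])
       (auto simp: curve_set_def indicator_def split: if_splits)
  then have "(\<lambda>z. 1 / (2 * of_real pi * \<i>) * (\<integral>t. ?f t / (?u t - z) \<partial>lborel)) holomorphic_on - curve_set g"
    by (intro holomorphic_intros)
  then show "(\<lambda>z. curve_integral_2pii g (\<lambda>w. (1 / (w - z)) \<cdot>\<^sub>m F w) $ i $ j) holomorphic_on - curve_set g"
  proof (rule holomorphic_transform)
    fix z assume "z \<in> - curve_set g"
    then have "curve_integrable g (\<lambda>w. (1 / (w - z)) \<cdot>\<^sub>m F w)"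
      using curve_integrable_cauchy_kernel[OF g _ F] by simp
    then show "1 / (2 * of_real pi * \<i>) * (\<integral>t. ?f t / (?u t - z) \<partial>lborel)
        = curve_integral_2pii g (\<lambda>w. (1 / (w - z)) \<cdot>\<^sub>m F w) $ i $ j"
      by (auto simp: curve_integral_2pii_def curve_integral_nth set_lebesgue_integral_def
            indicator_def intro!: Bochner_Integration.integral_cong)
  qed
qed

subsection \<open>Biorthogonal polynomials\<close>

text \<open>The number \<open>n\<close> counts coefficients and is not the degree. The empty sum is
  allowed, so the zero difference quotient of a constant is covered.\<close>

definition mat_poly :: "(complex \<Rightarrow> 'n::finite cmat) \<Rightarrow> bool"
  where "mat_poly P \<longleftrightarrow> (\<exists>n c. \<forall>z. P z = (\<Sum>k<n. z ^ k \<cdot>\<^sub>m c k))"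

lemma mat_polyI: "(\<And>z. P z = (\<Sum>k<n. z ^ k \<cdot>\<^sub>m c k)) \<Longrightarrow> mat_poly P"
  unfolding mat_poly_def by blast

lemma matrix_mult_sum_left: "(\<Sum>k\<in>I. F k) ** A = (\<Sum>k\<in>I. F k ** A)"
  for A :: "complex^'n^'n"
  by (induction I rule: infinite_finite_induct) (simp_all add: matrix_mult_add_left)

lemma matrix_mult_sum_right: "A ** (\<Sum>k\<in>I. F k) = (\<Sum>k\<in>I. A ** F k)"
  for A :: "complex^'n^'n"
  by (induction I rule: infinite_finite_induct) (simp_all add: matrix_add_ldistrib)

lemma smult_mat_sum: "c \<cdot>\<^sub>m (\<Sum>k\<in>I. F k) = (\<Sum>k\<in>I. c \<cdot>\<^sub>m F k)"
  by (induction I rule: infinite_finite_induct) (simp_all add: smult_mat_add)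

lemma monic_mat_poly_sum:
  assumes "monic_mat_poly n P"
  obtains c where "\<And>z. P z = (\<Sum>k<Suc n. z ^ k \<cdot>\<^sub>m c k)" "c n = mat 1"
proof -
  obtain c where c: "\<And>z. P z = z ^ n \<cdot>\<^sub>m mat 1 + (\<Sum>k<n. z ^ k \<cdot>\<^sub>m c k)"
    using assms unfolding monic_mat_poly_def by blast
  have "P z = (\<Sum>k<Suc n. z ^ k \<cdot>\<^sub>m (c(n := mat 1)) k)" for z
    by (simp add: c add.commute)
  then show ?thesis by (rule that) simp
qed

lemma monic_mat_poly_imp_mat_poly: "monic_mat_poly n P \<Longrightarrow> mat_poly P"
  by (erule monic_mat_poly_sum) (rule mat_polyI)

lemma monic_mat_poly_0: "monic_mat_poly 0 P \<Longrightarrow> P z = mat 1"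
  by (auto simp: monic_mat_poly_def)

lemma mat_poly_monomial: "mat_poly (\<lambda>z. z ^ k \<cdot>\<^sub>m A)"
proof (rule mat_polyI)
  fix z
  have "(\<Sum>i<k. z ^ i \<cdot>\<^sub>m (if i = k then A else 0)) = 0"
    by (rule sum.neutral) simp
  then show "z ^ k \<cdot>\<^sub>m A = (\<Sum>i<Suc k. z ^ i \<cdot>\<^sub>m (if i = k then A else 0))"
    by simp
qed

lemma mat_holomorphic_on_mat_poly: "mat_poly P \<Longrightarrow> mat_holomorphic_on P S"
proof -
  assume "mat_poly P"
  then obtain n c where "P = (\<lambda>z. \<Sum>k<n. z ^ k \<cdot>\<^sub>m c k)" unfolding mat_poly_def by auto
  then show ?thesis
    by (simp only:) (intro mat_holomorphic_on_sum mat_holomorphic_on_smult mat_holomorphic_on_const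
        holomorphic_intros)
qed

text \<open>Induction on the degree by the factorisation of w^(n+1) - z^(n+1). The coefficients
  \<open>e\<close> may depend on \<open>z\<close> but not on \<open>w\<close>. The top coefficient
  is recorded because it alone can survive orthogonality; for n = 0 there is none.\<close>

lemma mat_poly_difference_quotient:
  fixes c :: "nat \<Rightarrow> 'n::finite cmat"
  shows "\<exists>e. (\<forall>w. (\<Sum>k<Suc n. w ^ k \<cdot>\<^sub>m c k) - (\<Sum>k<Suc n. z ^ k \<cdot>\<^sub>m c k)
      = (w - z) \<cdot>\<^sub>m (\<Sum>i<n. w ^ i \<cdot>\<^sub>m e i)) \<and> (\<forall>m. n = Suc m \<longrightarrow> e m = c n)"
proof (induction n)
    case 0
    show ?case by simp
  next
    case (Suc n)
    then obtain e where e: "\<And>w. (\<Sum>k<Suc n. w ^ k \<cdot>\<^sub>m c k) - (\<Sum>k<Suc n. z ^ k \<cdot>\<^sub>m c k)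
      = (w - z) \<cdot>\<^sub>m (\<Sum>i<n. w ^ i \<cdot>\<^sub>m e i)" by blast
    \<comment> \<open>The old quotient is cut off at \<open>n\<close>, where \<open>e\<close> is no
      longer determined, and the quotient of the new top term is added; at i = n only the latter
      remains.\<close>
    define e' where "e' = (\<lambda>i. (if i < n then e i else 0) + z ^ (n - i) \<cdot>\<^sub>m c (Suc n))"
    have top: "w ^ Suc n \<cdot>\<^sub>m A - z ^ Suc n \<cdot>\<^sub>m A
        = (w - z) \<cdot>\<^sub>m (\<Sum>i<Suc n. w ^ i \<cdot>\<^sub>m z ^ (n - i) \<cdot>\<^sub>m A)" for w and A :: "'n cmat"
    proof -
      have "w ^ Suc n \<cdot>\<^sub>m A - z ^ Suc n \<cdot>\<^sub>m A = (w ^ Suc n - z ^ Suc n) \<cdot>\<^sub>m A"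
        by (simp add: vec_eq_iff left_diff_distrib)
      also have "\<dots> = (w - z) \<cdot>\<^sub>m (\<Sum>i<Suc n. w ^ i \<cdot>\<^sub>m z ^ (n - i) \<cdot>\<^sub>m A)"
        unfolding diff_power_eq_sum
        by (simp only: vec_eq_iff smult_mat_nth sum_component sum_distrib_right mult.assoc) simp
      finally show ?thesis .
    qed
    have "(\<Sum>k<Suc (Suc n). w ^ k \<cdot>\<^sub>m c k) - (\<Sum>k<Suc (Suc n). z ^ k \<cdot>\<^sub>m c k)
        = (w - z) \<cdot>\<^sub>m (\<Sum>i<Suc n. w ^ i \<cdot>\<^sub>m e' i)" for w
    proof -
      have "(\<Sum>i<Suc n. w ^ i \<cdot>\<^sub>m e' i)
          = (\<Sum>i<Suc n. w ^ i \<cdot>\<^sub>m (if i < n then e i else 0))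
            + (\<Sum>i<Suc n. w ^ i \<cdot>\<^sub>m z ^ (n - i) \<cdot>\<^sub>m c (Suc n))"
        by (simp only: e'_def smult_mat_add sum.distrib)
      also have "(\<Sum>i<Suc n. w ^ i \<cdot>\<^sub>m (if i < n then e i else 0)) = (\<Sum>i<n. w ^ i \<cdot>\<^sub>m e i)"
        by simp
      finally have "(w - z) \<cdot>\<^sub>m (\<Sum>i<Suc n. w ^ i \<cdot>\<^sub>m e' i)
          = ((\<Sum>k<Suc n. w ^ k \<cdot>\<^sub>m c k) - (\<Sum>k<Suc n. z ^ k \<cdot>\<^sub>m c k))
            + (w ^ Suc n \<cdot>\<^sub>m c (Suc n) - z ^ Suc n \<cdot>\<^sub>m c (Suc n))"
        by (simp only: smult_mat_add e top)
      then show ?thesis by (simp only: sum.lessThan_Suc[of _ "Suc n"]) (simp only: algebra_simps)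
    qed
    moreover have "e' n = c (Suc n)" by (simp add: e'_def)
    ultimately show ?case by blast
qed

lemma monic_mat_poly_difference_quotient:
  assumes "monic_mat_poly n P"
  obtains e where "\<And>w. P w - P z = (w - z) \<cdot>\<^sub>m (\<Sum>i<n. w ^ i \<cdot>\<^sub>m e i)"
    "\<And>m. n = Suc m \<Longrightarrow> e m = mat 1"
proof -
  obtain c where c: "\<And>z. P z = (\<Sum>k<Suc n. z ^ k \<cdot>\<^sub>m c k)" "c n = mat 1"
    using monic_mat_poly_sum[OF assms] by blast
  obtain e where e: "\<And>w. (\<Sum>k<Suc n. w ^ k \<cdot>\<^sub>m c k) - (\<Sum>k<Suc n. z ^ k \<cdot>\<^sub>m c k)
      = (w - z) \<cdot>\<^sub>m (\<Sum>i<n. w ^ i \<cdot>\<^sub>m e i)" "\<And>m. n = Suc m \<Longrightarrow> e m = c n"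
    using mat_poly_difference_quotient[of c n z] by blast
  show ?thesis
    by (rule that[of e]) (use e c(2) in \<open>auto simp only: c(1)\<close>)
qed

section \<open>Second kind functions of a weight with finite moments\<close>

locale moments_on_curve =
  fixes g :: "real \<Rightarrow> complex" and W :: "complex \<Rightarrow> 'n::finite cmat"
  assumes cont: "continuous_on {0..} g" and closed: "closed (curve_set g)"
    and moments: "\<And>n. curve_integrable g (\<lambda>z. z ^ n \<cdot>\<^sub>m W z)"
begin

text \<open>Expanding both polynomials gives a finite sum of moment integrands between constant
  matrices.\<close>

lemma integrable_poly_weight:
  assumes "mat_poly P" "mat_poly R"
  shows "curve_integrable g (\<lambda>z. P z ** W z ** R z)"
proof -
  obtain n c where c: "\<And>z. P z = (\<Sum>k<n. z ^ k \<cdot>\<^sub>m c k)"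
    using assms(1) unfolding mat_poly_def by blast
  obtain m d where d: "\<And>z. R z = (\<Sum>k<m. z ^ k \<cdot>\<^sub>m d k)"
    using assms(2) unfolding mat_poly_def by blast
  have monomials: "curve_integrable g (\<lambda>z. c k ** (z ^ (l + k) \<cdot>\<^sub>m W z) ** d l)" for k l
    by (intro curve_integral_mult_left(1) curve_integral_mult_right(1) moments)
  have "P z ** W z ** R z = (\<Sum>l<m. \<Sum>k<n. c k ** (z ^ (l + k) \<cdot>\<^sub>m W z) ** d l)" for z
    unfolding c d
    by (simp add: matrix_mult_sum_left matrix_mult_sum_right smult_mat_sum matrix_mul_assoc power_add)
  then show ?thesis
    by (simp only:) (intro curve_integral_sum[THEN conjunct1] finite_lessThan monomials)
qed

text \<open>One polynomial is taken to be the identity, written as a monomial of degree 0, and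
  simplification removes it.\<close>

lemmas integrable_poly_weight_left = integrable_poly_weight[OF _ mat_poly_monomial[of 0 "mat 1"], simplified]
  and integrable_poly_weight_right = integrable_poly_weight[OF mat_poly_monomial[of 0 "mat 1"], simplified]

text \<open>On the curve, \<open>P(w) W(w) R(z) - P(z) W(w) R(w)\<close> is \<open>w - z\<close> times
  \<open>E(w) W(w) R(w) - P(w) W(w) D(w)\<close>, so the Cauchy kernel cancels.\<close>

lemma second_kind_commutator:
  assumes z: "z \<notin> curve_set g" and P: "mat_poly P" and R: "mat_poly R"
    and E: "mat_poly E" "\<And>w. P w - P z = (w - z) \<cdot>\<^sub>m E w"
    and D: "mat_poly D" "\<And>w. R w - R z = (w - z) \<cdot>\<^sub>m D w"
  shows "second_kind_L g W P z ** R z - P z ** second_kind_R g W R z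
    = curve_integral_2pii g (\<lambda>w. E w ** W w ** R w) - curve_integral_2pii g (\<lambda>w. P w ** W w ** D w)"
proof -
  note kernel = curve_integrable_cauchy_kernel[OF cont closed z]
  have L: "curve_integrable g (\<lambda>w. (1 / (w - z)) \<cdot>\<^sub>m (P w ** W w))"
    by (rule kernel[OF integrable_poly_weight_left[OF P]])
  have Rt: "curve_integrable g (\<lambda>w. (1 / (w - z)) \<cdot>\<^sub>m (W w ** R w))"
    by (rule kernel[OF integrable_poly_weight_right[OF R]])
  have "second_kind_L g W P z ** R z - P z ** second_kind_R g W R z
      = curve_integral_2pii g (\<lambda>w. ((1 / (w - z)) \<cdot>\<^sub>m (P w ** W w)) ** R z
          - P z ** ((1 / (w - z)) \<cdot>\<^sub>m (W w ** R w)))"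
    unfolding second_kind_L_def second_kind_R_def
      curve_integral_mult_right(2)[OF L, symmetric] curve_integral_mult_left(2)[OF Rt, symmetric]
    by (rule curve_integral_diff(2)[symmetric])
       (rule curve_integral_mult_right(1)[OF L] curve_integral_mult_left(1)[OF Rt])+
  also have "\<dots> = curve_integral_2pii g (\<lambda>w. E w ** W w ** R w - P w ** W w ** D w)"
  proof (rule curve_integral_cong(2))
    fix w assume "w \<in> curve_set g"
    then have wz: "w - z \<noteq> 0" using z by auto
    have "(w - z) \<cdot>\<^sub>m (E w ** W w ** R w - P w ** W w ** D w)
        = ((w - z) \<cdot>\<^sub>m E w) ** W w ** R w - P w ** W w ** ((w - z) \<cdot>\<^sub>m D w)"
      by (simp add: smult_mat_diff)
    also have "\<dots> = (P w - P z) ** W w ** R w - P w ** W w ** (R w - R z)"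
      by (simp only: E(2) D(2))
    \<comment> \<open>The two terms with both polynomials at \<open>w\<close> cancel; what is left
      is the numerator of the commutator.\<close>
    also have "\<dots> = P w ** W w ** R z - P z ** (W w ** R w)"
      by (simp add: matrix_mult_diff_left matrix_mult_diff_right matrix_mul_assoc)
    finally have "(1 / (w - z)) \<cdot>\<^sub>m ((w - z) \<cdot>\<^sub>m (E w ** W w ** R w - P w ** W w ** D w))
        = (1 / (w - z)) \<cdot>\<^sub>m (P w ** W w ** R z - P z ** (W w ** R w))"
      by simp
    then show "((1 / (w - z)) \<cdot>\<^sub>m (P w ** W w)) ** R z - P z ** ((1 / (w - z)) \<cdot>\<^sub>m (W w ** R w))
        = E w ** W w ** R w - P w ** W w ** D w"
      using wz by (simp add: smult_mat_diff)
  qed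
  also have "\<dots> = curve_integral_2pii g (\<lambda>w. E w ** W w ** R w)
      - curve_integral_2pii g (\<lambda>w. P w ** W w ** D w)"
    by (rule curve_integral_diff(2)[OF integrable_poly_weight[OF E(1) R] integrable_poly_weight[OF P D(1)]])
  finally show ?thesis .
qed

section \<open>Consequences of biorthogonality\<close>

context
  fixes PL PR :: "nat \<Rightarrow> complex \<Rightarrow> 'n cmat" and C :: "nat \<Rightarrow> 'n cmat"
  assumes bi: "biorthogonal g W PL PR C"
begin

lemma
  shows monic_L: "monic_mat_poly n (PL n)" and monic_R: "monic_mat_poly n (PR n)"
    and C_inv: "invertible (C n)"
    and orth_L: "k \<le> n \<Longrightarrow> curve_integral_2pii g (\<lambda>z. z ^ k \<cdot>\<^sub>m (PL n z ** W z))
      = (if n = k then matrix_inv (C n) else 0)"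
    and orth_R: "k \<le> n \<Longrightarrow> curve_integral_2pii g (\<lambda>z. z ^ k \<cdot>\<^sub>m (W z ** PR n z))
      = (if n = k then matrix_inv (C n) else 0)"
  using bi by (auto simp: biorthogonal_def)

lemmas poly_L = monic_mat_poly_imp_mat_poly[OF monic_L]
  and poly_R = monic_mat_poly_imp_mat_poly[OF monic_R]

text \<open>The sum has degree below \<open>m\<close>, hence at most \<open>k\<close>, so every
  coefficient except that of w^k is annihilated; this one is present exactly when
  \<open>m = Suc k\<close>.\<close>

lemma orth_poly_R:
  assumes "m \<le> Suc k"
  shows "curve_integral_2pii g (\<lambda>w. (\<Sum>i<m. w ^ i \<cdot>\<^sub>m e i) ** W w ** PR k w)
    = (if m = Suc k then e k ** matrix_inv (C k) else 0)"
proof -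
  have eq: "(\<Sum>i<m. w ^ i \<cdot>\<^sub>m e i) ** W w ** PR k w = (\<Sum>i<m. e i ** (w ^ i \<cdot>\<^sub>m (W w ** PR k w)))" for w
    by (simp add: matrix_mult_sum_left matrix_mul_assoc)
  have int: "curve_integrable g (\<lambda>w. w ^ i \<cdot>\<^sub>m (W w ** PR k w))" for i
    using integrable_poly_weight[OF mat_poly_monomial[of i "mat 1"] poly_R[of k]] by simp
  have "curve_integral_2pii g (\<lambda>w. (\<Sum>i<m. w ^ i \<cdot>\<^sub>m e i) ** W w ** PR k w)
      = (\<Sum>i<m. curve_integral_2pii g (\<lambda>w. e i ** (w ^ i \<cdot>\<^sub>m (W w ** PR k w))))"
    unfolding eq
    by (rule curve_integral_sum[THEN conjunct2, OF finite_lessThan curve_integral_mult_left(1)[OF int]])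
  also have "\<dots> = (\<Sum>i<m. if i = k then e k ** matrix_inv (C k) else 0)"
    unfolding curve_integral_mult_left(2)[OF int]
    using assms by (intro sum.cong refl) (auto simp: orth_R)
  also have "\<dots> = (if m = Suc k then e k ** matrix_inv (C k) else 0)"
    using assms by auto
  finally show ?thesis .
qed

lemma orth_poly_L:
  assumes "k \<le> Suc m"
  shows "curve_integral_2pii g (\<lambda>w. PL m w ** W w ** (\<Sum>i<k. w ^ i \<cdot>\<^sub>m e i))
    = (if k = Suc m then matrix_inv (C m) ** e m else 0)"
proof -
  have eq: "PL m w ** W w ** (\<Sum>i<k. w ^ i \<cdot>\<^sub>m e i) = (\<Sum>i<k. (w ^ i \<cdot>\<^sub>m (PL m w ** W w)) ** e i)" for w
    by (simp add: matrix_mult_sum_right)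
  have int: "curve_integrable g (\<lambda>w. w ^ i \<cdot>\<^sub>m (PL m w ** W w))" for i
    using integrable_poly_weight[OF poly_L[of m] mat_poly_monomial[of i "mat 1"]] by simp
  have "curve_integral_2pii g (\<lambda>w. PL m w ** W w ** (\<Sum>i<k. w ^ i \<cdot>\<^sub>m e i))
      = (\<Sum>i<k. curve_integral_2pii g (\<lambda>w. (w ^ i \<cdot>\<^sub>m (PL m w ** W w)) ** e i))"
    unfolding eq
    by (rule curve_integral_sum[THEN conjunct2, OF finite_lessThan curve_integral_mult_right(1)[OF int]])
  also have "\<dots> = (\<Sum>i<k. if i = m then matrix_inv (C m) ** e m else 0)"
    unfolding curve_integral_mult_right(2)[OF int]
    using assms by (intro sum.cong refl) (auto simp: orth_L)
  also have "\<dots> = (if k = Suc m then matrix_inv (C m) ** e m else 0)"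
    using assms by auto
  finally show ?thesis .
qed

text \<open>The difference quotients have degrees m - 1 and k - 1. The bounds on \<open>m\<close>
  and \<open>k\<close> keep them within reach of orthogonality, and being monic they contribute
  \<open>matrix_inv (C k)\<close> or \<open>matrix_inv (C m)\<close> in the extreme cases.\<close>

lemma second_kind_relation:
  assumes z: "z \<notin> curve_set g" and mk: "m \<le> Suc k" "k \<le> Suc m"
  shows "second_kind_L g W (PL m) z ** PR k z - PL m z ** second_kind_R g W (PR k) z
    = (if m = Suc k then matrix_inv (C k) else 0) - (if k = Suc m then matrix_inv (C m) else 0)"
proof -
  obtain e where e: "\<And>w. PL m w - PL m z = (w - z) \<cdot>\<^sub>m (\<Sum>i<m. w ^ i \<cdot>\<^sub>m e i)"
    "\<And>l. m = Suc l \<Longrightarrow> e l = mat 1"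
    by (rule monic_mat_poly_difference_quotient[OF monic_L, of m z]) blast
  obtain d where d: "\<And>w. PR k w - PR k z = (w - z) \<cdot>\<^sub>m (\<Sum>i<k. w ^ i \<cdot>\<^sub>m d i)"
    "\<And>l. k = Suc l \<Longrightarrow> d l = mat 1"
    by (rule monic_mat_poly_difference_quotient[OF monic_R, of k z]) blast
  have "mat_poly (\<lambda>w. \<Sum>i<m. w ^ i \<cdot>\<^sub>m e i)" "mat_poly (\<lambda>w. \<Sum>i<k. w ^ i \<cdot>\<^sub>m d i)"
    by (rule mat_polyI[OF refl])+
  note comm = second_kind_commutator[OF z poly_L poly_R this(1) e(1) this(2) d(1)]
  show ?thesis
    unfolding comm orth_poly_R[OF mk(1)] orth_poly_L[OF mk(2)]
    by (auto simp: e(2) d(2))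
qed

lemma second_kind_relation_diag:
  assumes "z \<notin> curve_set g"
  shows "second_kind_L g W (PL m) z ** PR m z = PL m z ** second_kind_R g W (PR m) z"
  using second_kind_relation[OF assms, of m m] by simp

lemma second_kind_relation_lower:
  assumes "z \<notin> curve_set g"
  shows "second_kind_L g W (PL (Suc m)) z ** PR m z
    = PL (Suc m) z ** second_kind_R g W (PR m) z + matrix_inv (C m)"
  using second_kind_relation[OF assms, of "Suc m" m] by (simp add: diff_eq_eq add.commute)

lemma second_kind_relation_upper:
  assumes "z \<notin> curve_set g"
  shows "PL m z ** second_kind_R g W (PR (Suc m)) z
    = second_kind_L g W (PL m) z ** PR (Suc m) z + matrix_inv (C m)"
  using second_kind_relation[OF assms, of m "Suc m"] by (simp add: algebra_simps)

lemma
  assumes z: "z \<notin> curve_set g"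
  shows invertible_Y_L: "invertible (Y_L g W PL C n z)"
    and invertible_Y_R: "invertible (Y_R g W PR C n z)"
proof -
  have "invertible (Y_L g W PL C n z) \<and> invertible (Y_R g W PR C n z)"
  proof (cases n)
    case 0
    have PL0: "PL 0 z = mat 1" and PR0: "PR 0 z = mat 1"
      using monic_L monic_R monic_mat_poly_0 by blast+
    \<comment> \<open>For n = 0 this equality is the only one of the four block equations that is
      not immediate.\<close>
    have "second_kind_L g W (PL 0) z = second_kind_R g W (PR 0) z"
      using second_kind_relation_diag[OF z, of 0] by (simp add: PL0 PR0)
    then show ?thesis
      using block_mat_cross_inverse[of "mat 1" "mat 1" "second_kind_L g W (PL 0) z" 0 "mat 1"
          "second_kind_R g W (PR 0) z" 0 "mat 1"]
      by (simp add: 0 Y_L_def Y_R_def PL0 PR0)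
  next
    case (Suc m)
    note CC = matrix_inv_left_right[OF C_inv[of m]]
      \<comment> \<open>Equation \<open>1\<close> is the lower relation times \<open>C m\<close>
        from the right, \<open>3\<close> the diagonal relation between two factors
        \<open>C m\<close>, and \<open>4\<close> the upper relation times \<open>C m\<close> from
        the left.\<close>
      have 1: "PL (Suc m) z ** - (second_kind_R g W (PR m) z ** C m)
          - second_kind_L g W (PL (Suc m)) z ** - (PR m z ** C m) = mat 1"
        by (simp add: matrix_mul_assoc second_kind_relation_lower[OF z] matrix_mult_add_left CC)
      have 2: "second_kind_L g W (PL (Suc m)) z ** PR (Suc m) z
          = PL (Suc m) z ** second_kind_R g W (PR (Suc m)) z"
        by (rule second_kind_relation_diag[OF z])
      have 3: "- (C m ** PL m z) ** - (second_kind_R g W (PR m) z ** C m)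
          = - (C m ** second_kind_L g W (PL m) z) ** - (PR m z ** C m)"
      proof -
        have "C m ** (PL m z ** second_kind_R g W (PR m) z) ** C m
            = C m ** (second_kind_L g W (PL m) z ** PR m z) ** C m"
          by (simp only: second_kind_relation_diag[OF z])
        then show ?thesis by (simp add: matrix_mul_assoc)
      qed
      have 4: "- (C m ** second_kind_L g W (PL m) z) ** PR (Suc m) z
          - - (C m ** PL m z) ** second_kind_R g W (PR (Suc m)) z = mat 1"
      proof -
        have "C m ** (PL m z ** second_kind_R g W (PR (Suc m)) z)
            = C m ** (second_kind_L g W (PL m) z ** PR (Suc m) z) + mat 1"
          by (simp only: second_kind_relation_upper[OF z] matrix_add_ldistrib CC)
        then show ?thesis by (simp add: matrix_mul_assoc)
      qed
    from block_mat_cross_inverse[OF 1 2 3 4] show ?thesis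
      by (simp add: Suc Y_L_def Y_R_def)
  qed
  then show "invertible (Y_L g W PL C n z)" "invertible (Y_R g W PR C n z)" by auto
qed

lemma
  shows holomorphic_second_kind_L: "mat_holomorphic_on (second_kind_L g W (PL n)) (- curve_set g)"
    and holomorphic_second_kind_R: "mat_holomorphic_on (second_kind_R g W (PR n)) (- curve_set g)"
  unfolding second_kind_L_def[abs_def] second_kind_R_def[abs_def]
  by (rule mat_holomorphic_on_cauchy_transform[OF cont closed integrable_poly_weight_left[OF poly_L]],
      rule mat_holomorphic_on_cauchy_transform[OF cont closed integrable_poly_weight_right[OF poly_R]])

lemma
  shows holomorphic_Y_L: "mat_holomorphic_on (Y_L g W PL C n) (- curve_set g)"
    and holomorphic_Y_R: "mat_holomorphic_on (Y_R g W PR C n) (- curve_set g)"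
proof -
  note QL = holomorphic_second_kind_L and QR = holomorphic_second_kind_R
    and PL = mat_holomorphic_on_mat_poly[OF poly_L] and PR = mat_holomorphic_on_mat_poly[OF poly_R]
    and [simp] = mat_holomorphic_on_const mat_holomorphic_on_minus mat_holomorphic_on_mult
  have "mat_holomorphic_on (Y_L g W PL C n) (- curve_set g) \<and>
      mat_holomorphic_on (Y_R g W PR C n) (- curve_set g)"
    by (cases n) (simp_all add: Y_L_def[abs_def] Y_R_def[abs_def] mat_holomorphic_on_block PL PR QL QR)
  then show "mat_holomorphic_on (Y_L g W PL C n) (- curve_set g)"
    "mat_holomorphic_on (Y_R g W PR C n) (- curve_set g)" by auto
qed

end

end

subsection \<open>The second order equations\<close>

theorem proposition5:
  fixes g :: "real \<Rightarrow> complex"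
    and lg lgp :: "complex \<Rightarrow> complex"
    and hL hR WL WR HL HR W :: "complex \<Rightarrow> complex ^ 'n::finite ^ 'n"
    and AL AR W0L W0R :: "complex ^ 'n ^ 'n"
    and PL PR :: "nat \<Rightarrow> complex \<Rightarrow> complex ^ 'n ^ 'n"
    and C :: "nat \<Rightarrow> complex ^ 'n ^ 'n"
    and YL YR ZL ZR MtL MtR :: "nat \<Rightarrow> complex \<Rightarrow> complex ^ ('n + 'n) ^ ('n + 'n)"
  defines "YL \<equiv> Y_L g W PL C"
    and "YR \<equiv> Y_R g W PR C"
    and "ZL \<equiv> \<lambda>n. Z_L (YL n) WL WR"
    and "ZR \<equiv> \<lambda>n. Z_R (YR n) WL WR"
    and "MtL \<equiv> \<lambda>n z. z \<cdot>\<^sub>m M_L (ZL n) z"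
    and "MtR \<equiv> \<lambda>n z. z \<cdot>\<^sub>m M_R (ZR n) z"
  assumes "laguerre_curve g"
    and "log_branch (curve_set g) lg"
    and "has_left_boundary_values (curve_set g) lg lgp"
    and "pearson_L (curve_set g) lg hL WL HL AL W0L"
    and "pearson_R (curve_set g) lg hR WR HR AR W0R"
    and "has_left_boundary_values (curve_set g) (\<lambda>z. WL z ** WR z) W"
    and "laguerre_weight g lgp W"
    and "regular_weight g W"
    and "biorthogonal g W PL PR C"
  shows "\<forall>n. \<forall>z\<in>- curve_set g.
      z \<cdot>\<^sub>m mat_deriv (mat_deriv (YL n)) z
        + mat_deriv (YL n) z
            ** block_diag (2 \<cdot>\<^sub>m hL z + mat 1) (- (2 \<cdot>\<^sub>m hR z) + mat 1)
        + YL n z ** block_diag (calN hL z) (calN (\<lambda>w. - hR w) z)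
      = calN (MtL n) z ** YL n z
    \<and> z \<cdot>\<^sub>m mat_deriv (mat_deriv (YR n)) z
        + block_diag (2 \<cdot>\<^sub>m hR z + mat 1) (- (2 \<cdot>\<^sub>m hL z) + mat 1)
            ** mat_deriv (YR n) z
        + block_diag (calN hR z) (calN (\<lambda>w. - hL w) z) ** YR n z
      = YR n z ** calN (MtR n) z"
proof (intro allI ballI)
  fix n z assume z: "z \<in> - curve_set g"
  let ?S = "- curve_set g"
  have g: "continuous_on {0..} g" "filterlim g at_infinity at_top" "g 0 = 0"
    using \<open>laguerre_curve g\<close> by (simp_all add: laguerre_curve_def)
  note closed = curve_set_closed[OF g(1,2)]
  then have S: "open ?S" by (simp add: open_Compl)
  \<comment> \<open>The end point 0 lies on the curve, so the division by \<open>z\<close> in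
    \<open>calN\<close> is a genuine one off the curve.\<close>
  have "0 \<in> curve_set g"
    using g(3) by (auto simp: curve_set_def intro: image_eqI[of _ _ 0])
  then have z0: "z \<noteq> 0" using z by auto
  interpret moments_on_curve g W
    using g(1) closed \<open>laguerre_weight g lgp W\<close> by unfold_locales (auto simp: laguerre_weight_def)
  note bi = \<open>biorthogonal g W PL PR C\<close>
  have YL: "mat_holomorphic_on (YL n) ?S" "\<And>w. w \<in> ?S \<Longrightarrow> invertible (YL n w)"
    and YR: "mat_holomorphic_on (YR n) ?S" "\<And>w. w \<in> ?S \<Longrightarrow> invertible (YR n w)"
    unfolding YL_def YR_def
    using holomorphic_Y_L[OF bi] holomorphic_Y_R[OF bi] invertible_Y_L[OF bi] invertible_Y_R[OF bi]
    by auto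
  have L: "mat_holomorphic_on hL ?S" "mat_holomorphic_on WL ?S" "\<And>w. w \<in> ?S \<Longrightarrow> invertible (WL w)"
    "\<And>w. w \<in> ?S \<Longrightarrow> w \<cdot>\<^sub>m mat_deriv WL w = hL w ** WL w"
    using \<open>pearson_L (curve_set g) lg hL WL HL AL W0L\<close>
    by (auto simp: pearson_L_def pearson_data_def intro: mat_holomorphic_on_subset)
  have R: "mat_holomorphic_on hR ?S" "mat_holomorphic_on WR ?S" "\<And>w. w \<in> ?S \<Longrightarrow> invertible (WR w)"
    "\<And>w. w \<in> ?S \<Longrightarrow> w \<cdot>\<^sub>m mat_deriv WR w = WR w ** hR w"
    using \<open>pearson_R (curve_set g) lg hR WR HR AR W0R\<close>
    by (auto simp: pearson_R_def pearson_data_def intro: mat_holomorphic_on_subset)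
  note const0 = mat_holomorphic_on_const[of 0 ?S]
  have neg: "mat_holomorphic_on (\<lambda>w. - hL w) ?S" "mat_holomorphic_on (\<lambda>w. - hR w) ?S"
    using L(1) R(1) by (simp_all add: mat_holomorphic_on_minus)
  have inv: "mat_holomorphic_on (\<lambda>w. matrix_inv (WL w)) ?S" "mat_holomorphic_on (\<lambda>w. matrix_inv (WR w)) ?S"
    using mat_holomorphic_on_matrix_inv[OF L(2,3)] mat_holomorphic_on_matrix_inv[OF R(2,3)] by auto
  \<comment> \<open>Matches the coefficient 2 B + 1 of the general equation with the blockwise form
    in the statement.\<close>
  have coeff: "2 \<cdot>\<^sub>m block_diag A (- B) + mat 1 = block_diag (2 \<cdot>\<^sub>m A + mat 1) (- (2 \<cdot>\<^sub>m B) + mat 1)"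
    for A B :: "'n cmat"
    by (simp add: mat_one_block smult_block_mat block_mat_add)
  let ?DL = "\<lambda>w. block_diag (WL w) (matrix_inv (WR w))"
  let ?BL = "\<lambda>w. block_diag (hL w) (- hR w)"
  have "z \<cdot>\<^sub>m mat_deriv (mat_deriv (YL n)) z + mat_deriv (YL n) z ** (2 \<cdot>\<^sub>m ?BL z + mat 1)
      + YL n z ** calN ?BL z
    = calN (\<lambda>w. w \<cdot>\<^sub>m M_L (\<lambda>w. YL n w ** ?DL w) w) z ** YL n z"
  proof (rule second_order_L[OF S z z0 YL])
    show "mat_holomorphic_on ?DL ?S" "mat_holomorphic_on ?BL ?S"
      by (intro mat_holomorphic_on_block const0 L R inv neg)+
    fix w assume w: "w \<in> ?S"
    show "invertible (?DL w)"
      using w L R by (intro invertible_block_diag invertible_matrix_inv)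
    show "w \<cdot>\<^sub>m mat_deriv ?DL w = ?BL w ** ?DL w"
      using pearson_block_L[OF S w L(2) L(4)[OF w] R(2,3) R(4)[OF w]] .
  qed
  moreover have "MtL n = (\<lambda>w. w \<cdot>\<^sub>m M_L (\<lambda>w. YL n w ** ?DL w) w)"
    by (simp add: MtL_def ZL_def Z_L_def[abs_def])
  ultimately have eqL: "z \<cdot>\<^sub>m mat_deriv (mat_deriv (YL n)) z
        + mat_deriv (YL n) z ** block_diag (2 \<cdot>\<^sub>m hL z + mat 1) (- (2 \<cdot>\<^sub>m hR z) + mat 1)
        + YL n z ** block_diag (calN hL z) (calN (\<lambda>w. - hR w) z)
      = calN (MtL n) z ** YL n z"
    by (simp only: coeff calN_block_diag[OF S z L(1) neg(2)])
  \<comment> \<open>On this side D multiplies Y from the left and it is \<open>WL\<close> that is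
    inverted; its equation z W' = h W is of the kind that \<open>pearson_block_R\<close> requires of
    the inverted factor.\<close>
  let ?DR = "\<lambda>w. block_diag (WR w) (matrix_inv (WL w))"
  let ?BR = "\<lambda>w. block_diag (hR w) (- hL w)"
  have "z \<cdot>\<^sub>m mat_deriv (mat_deriv (YR n)) z + (2 \<cdot>\<^sub>m ?BR z + mat 1) ** mat_deriv (YR n) z
      + calN ?BR z ** YR n z
    = YR n z ** calN (\<lambda>w. w \<cdot>\<^sub>m M_R (\<lambda>w. ?DR w ** YR n w) w) z"
  proof (rule second_order_R[OF S z z0 YR])
    show "mat_holomorphic_on ?DR ?S" "mat_holomorphic_on ?BR ?S"
      by (intro mat_holomorphic_on_block const0 L R inv neg)+
    fix w assume w: "w \<in> ?S"
    show "invertible (?DR w)"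
      using w L R by (intro invertible_block_diag invertible_matrix_inv)
    show "w \<cdot>\<^sub>m mat_deriv ?DR w = ?DR w ** ?BR w"
      using pearson_block_R[OF S w R(2) R(4)[OF w] L(2,3) L(4)[OF w]] .
  qed
  moreover have "MtR n = (\<lambda>w. w \<cdot>\<^sub>m M_R (\<lambda>w. ?DR w ** YR n w) w)"
    by (simp add: MtR_def ZR_def Z_R_def[abs_def])
  ultimately have "z \<cdot>\<^sub>m mat_deriv (mat_deriv (YR n)) z
        + block_diag (2 \<cdot>\<^sub>m hR z + mat 1) (- (2 \<cdot>\<^sub>m hL z) + mat 1) ** mat_deriv (YR n) z
        + block_diag (calN hR z) (calN (\<lambda>w. - hL w) z) ** YR n z
      = YR n z ** calN (MtR n) z"
    by (simp only: coeff calN_block_diag[OF S z R(1) neg(1)])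
  with eqL show "z \<cdot>\<^sub>m mat_deriv (mat_deriv (YL n)) z
        + mat_deriv (YL n) z ** block_diag (2 \<cdot>\<^sub>m hL z + mat 1) (- (2 \<cdot>\<^sub>m hR z) + mat 1)
        + YL n z ** block_diag (calN hL z) (calN (\<lambda>w. - hR w) z)
      = calN (MtL n) z ** YL n z
    \<and> z \<cdot>\<^sub>m mat_deriv (mat_deriv (YR n)) z
        + block_diag (2 \<cdot>\<^sub>m hR z + mat 1) (- (2 \<cdot>\<^sub>m hL z) + mat 1) ** mat_deriv (YR n) z
        + block_diag (calN hR z) (calN (\<lambda>w. - hL w) z) ** YR n z
      = YR n z ** calN (MtR n) z" ..
qed

end
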